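(* Consider the linear regression model $Y = X\beta^* + \varepsilon$ with non-random $n\times p$ design matrix $X=(x_{ij})$, true parameter vector $\beta^*\in\mathbb{R}^p$, and i.i.d. $N(0,\sigma^2)$ errors. Let $\hat\beta^{\mathrm{CV}}$ be the cross-validated Lasso estimate (with user-chosen $\delta>0$, $N_1$, $N_2$) defined in the context. Let $L := |\beta^*|_1+\delta$ and $$M := \max_{1\le j\le p}\frac1n\sum_{i=1}^n x_{ij}^4,\qquad l_1 := \mathbb{E}\log(N_1+1),\qquad l_2 := \mathbb{E}\log(N_2+1).$$ Then $$\mathbb{E}\biggl(\frac{\|X\beta^*-X\hat\beta^{\mathrm{CV}}\|^2}{n};\ N_1\delta\ge|\beta^*|_1,\ N_2\delta\ge|\beta^*|_1\biggr)\le C_1\frac{\sqrt{l_1}+\sqrt{l_2}}{\sqrt n}+C_2\sqrt{\frac{\log(2p)}{n}}+E_n,$$ where $$C_1 = 16\,(4\sigma^4+2L^2M^{1/2}\sigma^2)^{1/2},\qquad C_2 = 96L^2M^{1/2}+57LM^{1/4}\sigma,$$ $$E_n = 16\biggl(\frac{(n+5)\sigma^4}{n}+\frac{(n+1)\sigma^2}{n}L^2M^{1/2}\biggr)^{1/2}\biggl(\frac{1+2^{-1/2}}{2}\biggr)^{n/2}.$$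
   Context: Notation: $\|\cdot\|$ is the Euclidean norm, $|\cdot|_1$ is the $\ell^1$ norm on $\mathbb{R}^p$; for a random variable $Z$ and event $A$, $\mathbb{E}(Z;A):=\mathbb{E}(Z1_A)$. Model: $n,p\ge1$; $X$ is an $n\times p$ non-random real matrix with rows $x_1,\dots,x_n$ (so $x_i\beta=\sum_j x_{ij}\beta_j$); $Y=X\beta^*+\varepsilon$, i.e. $y_i=x_i\beta^*+\varepsilon_i$, with $\varepsilon_1,\dots,\varepsilon_n$ i.i.d. $N(0,\sigma^2)$, $\sigma>0$. Cross-validated Lasso estimate: 1. $I\subseteq\{1,\dots,n\}$ is a random subset, independent of $\varepsilon$, obtained by independently putting each element into $I$ or $I^c$ with probability $1/2$ each. 2. For each $K\ge0$, $\hat\beta^{(K,1)}$ is a minimizer of $\sum_{i\in I}(y_i-x_i\beta)^2$ over $|\beta|_1\le K$, and $\hat\beta^{(K,2)}$ is a minimizer of $\sum_{i\in I^c}(y_i-x_i\beta)^2$ over $|\beta|_1\le K$. Ties are broken by some deterministic (measurable) rule. If $I$ (resp. $I^c$) is empty, $\hat\beta^{(K,1)}$ (resp. $\hat\beta^{(K,2)}$) is $0$ for all $K$. 3. $N_1,N_2$ are nonnegative integer-valued random variables, where $N_1$ is a function of $(y_i,x_i)_{i\in I^c}$ and $N_2$ is a function of $(y_i,x_i)_{i\in I}$. 4. $\delta>0$ is a fixed real number. $\hat K_1$ is a minimizer of $\sum_{i\in I}(y_i-x_i\hat\beta^{(K,2)})^2$ over $K\in\{0,\delta,2\delta,\dots,N_1\delta\}$;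 $\hat K_2$ is a minimizer of $\sum_{i\in I^c}(y_i-x_i\hat\beta^{(K,1)})^2$ over $K\in\{0,\delta,\dots,N_2\delta\}$. 5. Define $\hat\mu'\in\mathbb{R}^n$ by $\hat\mu'_i=x_i\hat\beta^{(\hat K_1,2)}$ if $i\in I$ and $\hat\mu'_i=x_i\hat\beta^{(\hat K_2,1)}$ if $i\in I^c$. For each $K\ge0$ let $\hat\beta^{(K)}$ be a minimizer of $\|Y-X\beta\|$ over $|\beta|_1\le K$. Let $\hat K$ be a minimizer of $\|\hat\mu'-X\hat\beta^{(K)}\|$ over $K\ge0$. 6. $\hat\beta^{\mathrm{CV}}:=\hat\beta^{(\hat K)}$. *)

theory Defs
  imports "HOL-Probability.Probability"
begin

definition l1_norm :: "real ^ 'p \<Rightarrow> real"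
  where "l1_norm b = (\<Sum>j\<in>UNIV. \<bar>b $ j\<bar>)"

(* The observations (y_i) for i in A, as a point of the product space PiM A. The rows x_i are
   non-random, so the family (y_i, x_i) for i in A carries the same information as A together
   with this point. *)
definition data_on :: "'n set \<Rightarrow> real ^ 'n \<Rightarrow> 'n \<Rightarrow> real"
  where "data_on A y = restrict (\<lambda>i. y $ i) A"

(* g turns the data on A and a level K into a constrained least squares estimate.
   That g A y K depends only on A, y and K, measurably in y, is the deterministic tie-breaking. *)
definition lasso_rule :: "real ^ 'p ^ 'n \<Rightarrow> ('n set \<Rightarrow> ('n \<Rightarrow> real) \<Rightarrow> real \<Rightarrow> real ^ 'p) \<Rightarrow> bool"
  where "lasso_rule X g \<longleftrightarrow>
    (\<forall>A. \<forall>K\<ge>0.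
      (\<lambda>y. g A y K) \<in> borel_measurable (PiM A (\<lambda>_. borel)) \<and>
      (\<forall>y\<in>space (PiM A (\<lambda>_. borel)).
        is_arg_min (\<lambda>b. \<Sum>i\<in>A. (y i - (X *v b) $ i)\<^sup>2) (\<lambda>b. l1_norm b \<le> K) (g A y K) \<and>
        (A = {} \<longrightarrow> g A y K = 0)))"

definition indep_random_variables ::
    "'w measure \<Rightarrow> 'a measure \<Rightarrow> ('w \<Rightarrow> 'a) \<Rightarrow> 'b measure \<Rightarrow> ('w \<Rightarrow> 'b) \<Rightarrow> bool"
  where "indep_random_variables P MA U MB V \<longleftrightarrow>
    U \<in> measurable P MA \<and> V \<in> measurable P MB \<and>
    prob_space.indep_set P {U -` S \<inter> space P | S. S \<in> sets MA} {V -` S \<inter> space P | S. S \<in> sets MB}"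

(* Square root on [0, \<infinity>], since the expectations of log (N + 1) may be infinite. *)
definition ennreal_sqrt :: "ennreal \<Rightarrow> ennreal"
  where "ennreal_sqrt a = (if a = \<infinity> then \<infinity> else ennreal (sqrt (enn2real a)))"

end

theory Submission imports Defs begin

text \<open>
  Fix the split \<open>I\<close> and write \<open>m = X \<beta>s\<close>, \<open>L = |\<beta>s|\<^sub>1 + \<delta>\<close>; choose the grid point \<open>k0 \<delta>\<close> in
  \<open>[|\<beta>s|\<^sub>1, L]\<close>. By the choice of the final level, the error of \<open>X \<beta>CV\<close> is at most twice the error of \<open>\<mu>\<close>
  plus the in-sample error of the full Lasso at level \<open>|\<beta>s|\<^sub>1\<close>; the latter is controlled by
  \<open>max\<^sub>j |\<Sum>\<^sub>i \<epsilon>\<^sub>i x\<^sub>i\<^sub>j|\<close> through the obtuse angle criterion. On each fold the squared error of the selected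
  candidate exceeds that of candidate \<open>k0\<close> by a linear form in the noise of that fold, whose coefficients
  depend only on the other fold. Freezing the other fold, the part belonging to \<open>k0\<close> is centred and the
  part belonging to the selected candidate is a maximum of \<open>N + 1\<close> normalised Gaussians times a
  residual norm, which yields \<open>sqrt (ln (N + 1))\<close> after a weighted AM-GM inequality. The out-of-sample error
  of candidate \<open>k0\<close> is its in-sample error plus a Rademacher quadratic form in the split.
\<close>

section \<open>Gaussian and subgaussian bounds\<close>

text \<open>Two obstacles shape the argument. The selected index depends on the noise of its own
  fold, so its linear form is not centred; and levels may reach \<open>N * \<delta>\<close>, so the
  selected candidate has no a priori bound on its norm. A sum of exponentials over all candidates
  removes the first, comparison with the zero estimate the second. The weights of the AM-GM steps
  stay free until all integrals have been taken. At that stage the bound is linear in the mean of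
  \<open>ln (N + 1)\<close>, and the best weight turns this mean into its square root. Optimising
  earlier would involve the product of a random logarithm and a random residual norm. For the same
  reason logarithms of sums are replaced by a tangent at a bound for the mean, a pointwise form of
  Jensen's inequality.\<close>

definition gauss :: "real \<Rightarrow> real measure"
  where "gauss \<sigma> = density lborel (normal_density 0 \<sigma>)"

lemma sets_gauss [simp, measurable_cong]: "sets (gauss \<sigma>) = sets borel"
  by (simp add: gauss_def)

lemma space_gauss [simp]: "space (gauss \<sigma>) = UNIV"
  by (simp add: gauss_def)

lemma prob_space_gauss: "\<sigma> > 0 \<Longrightarrow> prob_space (gauss \<sigma>)"
  unfolding gauss_def by (rule prob_space_normal_density)

text \<open>Completing the square turns the tilted density into a multiple of the normal density
  with mean \<open>t * \<sigma>\<^sup>2\<close>, whose total mass is 1.\<close>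

lemma gauss_mgf:
  assumes "\<sigma> > 0"
  shows "(\<integral>\<^sup>+x. ennreal (exp (t * x)) \<partial>gauss \<sigma>) = ennreal (exp (t\<^sup>2 * \<sigma>\<^sup>2 / 2))"
proof -
  have tilt: "normal_density 0 \<sigma> x * exp (t * x)
      = exp (t\<^sup>2 * \<sigma>\<^sup>2 / 2) * normal_density (t * \<sigma>\<^sup>2) \<sigma> x" for x
  proof -
    have "- x\<^sup>2 / (2 * \<sigma>\<^sup>2) + t * x = t\<^sup>2 * \<sigma>\<^sup>2 / 2 - (x - t * \<sigma>\<^sup>2)\<^sup>2 / (2 * \<sigma>\<^sup>2)"
      using assms by (simp add: field_simps power2_eq_square)
    then have "exp (- x\<^sup>2 / (2 * \<sigma>\<^sup>2)) * exp (t * x)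
        = exp (t\<^sup>2 * \<sigma>\<^sup>2 / 2) * exp (- (x - t * \<sigma>\<^sup>2)\<^sup>2 / (2 * \<sigma>\<^sup>2))"
      by (simp flip: exp_add)
    then show ?thesis
      by (simp add: normal_density_def)
  qed
  have "(\<integral>\<^sup>+x. ennreal (exp (t * x)) \<partial>gauss \<sigma>)
      = (\<integral>\<^sup>+x. ennreal (normal_density 0 \<sigma> x) * ennreal (exp (t * x)) \<partial>lborel)"
    unfolding gauss_def by (rule nn_integral_density) auto
  also have "\<dots> = (\<integral>\<^sup>+x. ennreal (exp (t\<^sup>2 * \<sigma>\<^sup>2 / 2)) * ennreal (normal_density (t * \<sigma>\<^sup>2) \<sigma> x) \<partial>lborel)"
    by (intro nn_integral_cong) (simp add: tilt flip: ennreal_mult)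
  also have "\<dots> = ennreal (exp (t\<^sup>2 * \<sigma>\<^sup>2 / 2))"
    using assms by (simp add: nn_integral_cmult nn_integral_eq_integral)
  finally show ?thesis .
qed

text \<open>Since 1/2 - 3/8 = 1/8, the weighted density is a multiple of the normal density with
  standard deviation 2; the factor 2 is the ratio of the two standard deviations.\<close>

lemma gauss_exp_square:
  "(\<integral>\<^sup>+x. ennreal (exp (3 / 8 * x\<^sup>2)) \<partial>gauss 1) = 2"
proof -
  have spread: "std_normal_density x * exp (3 / 8 * x\<^sup>2) = 2 * normal_density 0 2 x" for x
  proof -
    have "std_normal_density x * exp (3 / 8 * x\<^sup>2) = 1 / sqrt (2 * pi) * (exp (- x\<^sup>2 / 2) * exp (3 / 8 * x\<^sup>2))"
      by (simp add: std_normal_density_def)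
    also have "exp (- x\<^sup>2 / 2) * exp (3 / 8 * x\<^sup>2) = exp (- x\<^sup>2 / 8)"
      by (simp flip: exp_add)
    also have "1 / sqrt (2 * pi) * exp (- x\<^sup>2 / 8) = 2 * normal_density 0 2 x"
    proof -
      have "sqrt (8 * pi) = 2 * sqrt (2 * pi)"
        using real_sqrt_mult[of "2\<^sup>2" "2 * pi"] by simp
      then show ?thesis
        by (simp add: normal_density_def)
    qed
    finally show ?thesis .
  qed
  have "(\<integral>\<^sup>+x. ennreal (exp (3 / 8 * x\<^sup>2)) \<partial>gauss 1)
      = (\<integral>\<^sup>+x. ennreal (std_normal_density x) * ennreal (exp (3 / 8 * x\<^sup>2)) \<partial>lborel)"
    unfolding gauss_def by (rule nn_integral_density) auto
  also have "\<dots> = (\<integral>\<^sup>+x. 2 * ennreal (normal_density 0 2 x) \<partial>lborel)"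
  proof (intro nn_integral_cong)
    fix x
    have "ennreal (std_normal_density x) * ennreal (exp (3 / 8 * x\<^sup>2))
        = ennreal (std_normal_density x * exp (3 / 8 * x\<^sup>2))"
      by (simp add: ennreal_mult)
    also have "\<dots> = 2 * ennreal (normal_density 0 2 x)"
      by (simp only: spread) (simp add: ennreal_mult)
    finally show "ennreal (std_normal_density x) * ennreal (exp (3 / 8 * x\<^sup>2))
        = 2 * ennreal (normal_density 0 2 x)" .
  qed
  also have "\<dots> = 2"
    by (simp add: nn_integral_cmult nn_integral_eq_integral)
  finally show ?thesis .
qed

lemma gauss_PiM_mgf:
  assumes "\<sigma> > 0" and J: "finite J"
  shows "(\<integral>\<^sup>+z. ennreal (exp (t * (\<Sum>i\<in>J. c i * z i))) \<partial>PiM J (\<lambda>_. gauss \<sigma>))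
    = ennreal (exp (t\<^sup>2 * \<sigma>\<^sup>2 * (\<Sum>i\<in>J. (c i)\<^sup>2) / 2))"
proof -
  interpret prob_space "gauss \<sigma>" by (rule prob_space_gauss[OF assms(1)])
  interpret product_sigma_finite "\<lambda>_. gauss \<sigma>" by standard
  have "(\<integral>\<^sup>+z. ennreal (exp (t * (\<Sum>i\<in>J. c i * z i))) \<partial>PiM J (\<lambda>_. gauss \<sigma>))
      = (\<integral>\<^sup>+z. (\<Prod>i\<in>J. ennreal (exp ((t * c i) * z i))) \<partial>PiM J (\<lambda>_. gauss \<sigma>))"
    using J by (intro nn_integral_cong)
      (simp add: prod_ennreal sum_distrib_left mult.assoc flip: exp_sum)
  also have "\<dots> = (\<Prod>i\<in>J. ennreal (exp ((t * c i)\<^sup>2 * \<sigma>\<^sup>2 / 2)))"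
    by (subst product_nn_integral_prod[OF J]) (simp_all add: gauss_mgf[OF assms(1)])
  also have "\<dots> = ennreal (exp (\<Sum>i\<in>J. (t * c i)\<^sup>2 * \<sigma>\<^sup>2 / 2))"
    using J by (simp add: prod_ennreal exp_sum)
  also have "(\<Sum>i\<in>J. (t * c i)\<^sup>2 * \<sigma>\<^sup>2 / 2) = t\<^sup>2 * \<sigma>\<^sup>2 * (\<Sum>i\<in>J. (c i)\<^sup>2) / 2"
    by (simp add: sum_divide_distrib sum_distrib_left power_mult_distrib mult_ac)
  finally show ?thesis .
qed

text \<open>Since \<^prop>\<open>exp (s\<^sup>2 / 2) = E (exp (s * g))\<close> for a standard normal \<^term>\<open>g\<close>, the exponential square
  moment follows from the moment generating function and Fubini's theorem.\<close>

lemma gauss_PiM_exp_square: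
  assumes "\<sigma> > 0" and J: "finite J"
  shows "(\<integral>\<^sup>+z. ennreal (exp (3 / 8 * ((\<Sum>i\<in>J. c i * z i) / (\<sigma> * sqrt (\<Sum>i\<in>J. (c i)\<^sup>2)))\<^sup>2))
    \<partial>PiM J (\<lambda>_. gauss \<sigma>)) \<le> 2"
proof (cases "(\<Sum>i\<in>J. (c i)\<^sup>2) = 0")
  \<comment> \<open>Division by 0 yields 0, so the integrand is constantly 1. Only this degenerate
    case makes the bound an inequality.\<close>
  case True
  interpret prob_space "PiM J (\<lambda>_. gauss \<sigma>)"
    by (intro prob_space_PiM prob_space_gauss assms)
  show ?thesis
    using True by (simp add: emeasure_space_1)
next
  case False
  define s where "s = \<sigma> * sqrt (\<Sum>i\<in>J. (c i)\<^sup>2)"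
  have s2: "s\<^sup>2 = \<sigma>\<^sup>2 * (\<Sum>i\<in>J. (c i)\<^sup>2)"
    by (simp add: s_def power_mult_distrib sum_nonneg)
  have "s \<noteq> 0"
    using False assms by (simp add: s_def)
  interpret G: prob_space "gauss 1" by (rule prob_space_gauss) simp
  interpret Z: prob_space "PiM J (\<lambda>_. gauss \<sigma>)"
    by (intro prob_space_PiM prob_space_gauss assms)
  interpret pair_sigma_finite "gauss 1" "PiM J (\<lambda>_. gauss \<sigma>)" ..
  \<comment> \<open>As \<open>r\<^sup>2 / 2 = 3 / 8\<close>, the generating function of
    \<open>gauss 1\<close> produces the wanted exponential of a square.\<close>
  define r where "r = sqrt (3 / 4)"
  have r2: "r\<^sup>2 = 3 / 4" by (simp add: r_def)
  have "(\<integral>\<^sup>+z. ennreal (exp (3 / 8 * ((\<Sum>i\<in>J. c i * z i) / s)\<^sup>2)) \<partial>PiM J (\<lambda>_. gauss \<sigma>))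
      = (\<integral>\<^sup>+z. \<integral>\<^sup>+x. ennreal (exp ((r * (\<Sum>i\<in>J. c i * z i) / s) * x)) \<partial>gauss 1 \<partial>PiM J (\<lambda>_. gauss \<sigma>))"
    by (intro nn_integral_cong, subst gauss_mgf) (simp_all add: power_mult_distrib power_divide r2)
  also have "\<dots> = (\<integral>\<^sup>+x. \<integral>\<^sup>+z. ennreal (exp ((r * (\<Sum>i\<in>J. c i * z i) / s) * x)) \<partial>PiM J (\<lambda>_. gauss \<sigma>) \<partial>gauss 1)"
    by (rule Fubini') measurable
  also have "\<dots> = (\<integral>\<^sup>+x. \<integral>\<^sup>+z. ennreal (exp ((r * x / s) * (\<Sum>i\<in>J. c i * z i))) \<partial>PiM J (\<lambda>_. gauss \<sigma>) \<partial>gauss 1)"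
    by (simp add: mult_ac)
  also have "\<dots> = (\<integral>\<^sup>+x. ennreal (exp (3 / 8 * x\<^sup>2)) \<partial>gauss 1)"
  proof (intro nn_integral_cong)
    fix x
    have "(r * x / s)\<^sup>2 * \<sigma>\<^sup>2 * (\<Sum>i\<in>J. (c i)\<^sup>2) / 2 = (r * x / s)\<^sup>2 * s\<^sup>2 / 2"
      by (simp add: s2)
    also have "\<dots> = 3 / 8 * x\<^sup>2"
      using \<open>s \<noteq> 0\<close> by (simp add: power_mult_distrib power_divide r2)
    finally show "(\<integral>\<^sup>+z. ennreal (exp ((r * x / s) * (\<Sum>i\<in>J. c i * z i))) \<partial>PiM J (\<lambda>_. gauss \<sigma>))
        = ennreal (exp (3 / 8 * x\<^sup>2))"
      by (simp add: gauss_PiM_mgf[OF assms] del: times_divide_eq_left)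
  qed
  finally show ?thesis
    by (simp only: gauss_exp_square s_def order_refl)
qed

lemma gauss_PiM_coordinate:
  assumes "\<sigma> > 0" and "i \<in> J"
  shows "has_bochner_integral (PiM J (\<lambda>_. gauss \<sigma>)) (\<lambda>z. z i) 0"
    and "has_bochner_integral (PiM J (\<lambda>_. gauss \<sigma>)) (\<lambda>z. (z i)\<^sup>2) (\<sigma>\<^sup>2)"
proof -
  let ?P = "PiM J (\<lambda>_. gauss \<sigma>)"
  have proj: "(\<lambda>z. z i) \<in> measurable ?P (gauss \<sigma>)"
    using assms(2) by measurable
  have law: "distr ?P (gauss \<sigma>) (\<lambda>z. z i) = gauss \<sigma>"
    using assms by (intro distr_PiM_component prob_space_gauss) auto
  have transfer: "has_bochner_integral ?P (\<lambda>z. f (z i)) x"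
    if [measurable]: "f \<in> borel_measurable borel"
      and "has_bochner_integral lborel (\<lambda>x. normal_density 0 \<sigma> x * f x) x" for f :: "real \<Rightarrow> real" and x
  proof -
    have "has_bochner_integral (gauss \<sigma>) f x"
      unfolding gauss_def using that by (intro has_bochner_integral_density) auto
    then have "has_bochner_integral (distr ?P (gauss \<sigma>) (\<lambda>z. z i)) f x"
      by (simp add: law)
    then show ?thesis
      using proj that(1) by (simp add: has_bochner_integral_iff integrable_distr_eq integral_distr)
  qed
  show "has_bochner_integral ?P (\<lambda>z. z i) 0"
    using normal_moment_odd[OF assms(1), of 0 0] by (intro transfer) auto
  show "has_bochner_integral ?P (\<lambda>z. (z i)\<^sup>2) (\<sigma>\<^sup>2)"
    using normal_moment_even[OF assms(1), of 0 1] by (intro transfer) (auto simp: fact_2)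
qed

section \<open>Optimal weights and maxima of subgaussian variables\<close>

text \<open>For positive \<open>a\<close> and \<open>b\<close> the best weight is
  \<open>sqrt (b / a)\<close>. If one of them vanishes, the infimum is only approached, by very
  large or very small weights, hence the slack \<open>e\<close>; the summand 1 in the witnesses
  keeps them positive and finite when the other constant is 0 as well.\<close>

lemma le_two_sqrt_from_weights:
  fixes a b c x :: real
  assumes "a \<ge> 0" and "b \<ge> 0" and le: "\<And>t. t > 0 \<Longrightarrow> x \<le> c + t * a + b / t"
  shows "x \<le> c + 2 * sqrt (a * b)"
proof (rule field_le_epsilon)
  fix e :: real assume "e > 0"
  consider "a > 0" "b > 0" | "a = 0" | "b = 0"
    using assms(1,2) by linarith
  then show "x \<le> c + 2 * sqrt (a * b) + e"
  proof cases
    case 1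
    define p q where "p = sqrt a" and "q = sqrt b"
    have pq: "p > 0" "q > 0" "a = p * p" "b = q * q" "sqrt (a * b) = p * q"
      using 1 by (simp_all add: p_def q_def real_sqrt_mult)
    then show ?thesis
      using le[of "q / p"] \<open>e > 0\<close> by simp
  next
    case 2
    have "b / ((b + 1) / e) \<le> e"
      using assms(2) \<open>e > 0\<close> by (simp add: field_simps)
    then show ?thesis
      using le[of "(b + 1) / e"] 2 assms(2) \<open>e > 0\<close> by simp
  next
    case 3
    have "e / (a + 1) * a \<le> e"
      using assms(1) \<open>e > 0\<close> by (simp add: field_simps)
    then show ?thesis
      using le[of "e / (a + 1)"] 3 assms(1) \<open>e > 0\<close> by simp
  qed
qed

text \<open>The tangent of \<open>ln\<close> at \<open>x\<close>. With \<open>x\<close> an upper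
  bound for the mean of a random \<open>s\<close>, integrating it gives Jensen's bound
  \<open>ln x\<close>, but it can be applied before any integral is formed.\<close>

lemma ln_le_linear_at:
  fixes s x :: real
  assumes "s > 0" and "x > 0"
  shows "ln s \<le> s / x - 1 + ln x"
proof -
  have "ln (s / x) \<le> s / x - 1"
    using assms by (intro ln_le_minus_one) simp
  then show ?thesis
    using assms by (simp add: ln_div)
qed

text \<open>The largest \<open>t * \<bar>W j\<bar>\<close> is at most the logarithm of a sum of
  exponentials, two per index to cover both signs; this accounts for \<open>2 * card J\<close>. The
  tangent bound leaves \<open>ln (2 * card J) / t + t * v / 2\<close>, and \<open>t\<close> is
  optimised last.\<close>

lemma (in prob_space) expectation_Max_subgaussian:
  fixes W :: "'i \<Rightarrow> 'a \<Rightarrow> real"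
  assumes J: "finite J" "J \<noteq> {}" and "v \<ge> 0"
    and W [measurable]: "\<And>j. j \<in> J \<Longrightarrow> W j \<in> borel_measurable M"
    and mgf: "\<And>j t. j \<in> J \<Longrightarrow> (\<integral>\<^sup>+\<omega>. ennreal (exp (t * W j \<omega>)) \<partial>M) \<le> ennreal (exp (t\<^sup>2 * v / 2))"
  shows "(\<integral>\<^sup>+\<omega>. ennreal (Max ((\<lambda>j. \<bar>W j \<omega>\<bar>) ` J)) \<partial>M) \<le> ennreal (sqrt (2 * v * ln (2 * card J)))"
    (is "?E \<le> _")
proof -
  have card: "real (card J) \<ge> 1"
    using J by (simp add: Suc_le_eq card_gt_0_iff)
  have bound: "?E \<le> ennreal (ln (2 * card J) / t + t * (v / 2))" if "t > 0" for t
  proof -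
    \<comment> \<open>The point of tangency: an upper bound for the mean of
      \<open>S\<close>.\<close>
    define x where "x = 2 * card J * exp (t\<^sup>2 * v / 2)"
    have "x > 0" using card by (simp add: x_def)
    have lnx: "ln x = ln (2 * card J) + t\<^sup>2 * v / 2"
      using card by (simp add: x_def ln_mult)
    define S where "S \<omega> = (\<Sum>j\<in>J. exp (t * W j \<omega>) + exp (- t * W j \<omega>))" for \<omega>
    have S_pos: "S \<omega> > 0" for \<omega>
      unfolding S_def using J by (intro sum_pos) (auto intro: add_pos_pos)
    have int: "integrable M (\<lambda>\<omega>. exp (u * W j \<omega>)) \<and> expectation (\<lambda>\<omega>. exp (u * W j \<omega>)) \<le> exp (t\<^sup>2 * v / 2)"
      if "j \<in> J" "u\<^sup>2 = t\<^sup>2" for j u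
    proof -
      have le: "(\<integral>\<^sup>+\<omega>. ennreal (exp (u * W j \<omega>)) \<partial>M) \<le> ennreal (exp (t\<^sup>2 * v / 2))"
        using mgf[OF that(1), of u] that(2) by simp
      then have i: "integrable M (\<lambda>\<omega>. exp (u * W j \<omega>))"
        using that(1) by (intro integrableI_nonneg) (auto simp: le_less_trans)
      then show ?thesis
        using le by (subst (asm) nn_integral_eq_integral) auto
    qed
    have iS: "integrable M S"
      unfolding S_def using int[of _ t] int[of _ "- t"] by auto
    have "expectation S = (\<Sum>j\<in>J. expectation (\<lambda>\<omega>. exp (t * W j \<omega>)) + expectation (\<lambda>\<omega>. exp (- t * W j \<omega>)))"
      unfolding S_def using int[of _ t] int[of _ "- t"] by (simp add: Bochner_Integration.integral_sum)
    also have "\<dots> \<le> (\<Sum>j\<in>J. exp (t\<^sup>2 * v / 2) + exp (t\<^sup>2 * v / 2))"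
      using int[of _ t] int[of _ "- t"] by (intro sum_mono add_mono) auto
    also have "\<dots> = x"
      by (simp add: x_def)
    finally have ES: "expectation S \<le> x" .
    have pw: "Max ((\<lambda>j. \<bar>W j \<omega>\<bar>) ` J) \<le> (S \<omega> / x - 1 + ln x) / t" for \<omega>
    proof -
      have "\<bar>W j \<omega>\<bar> \<le> ln (S \<omega>) / t" if "j \<in> J" for j
      proof -
        have "exp (t * \<bar>W j \<omega>\<bar>) \<le> exp (t * W j \<omega>) + exp (- t * W j \<omega>)"
          by (simp add: abs_if)
        also have "\<dots> \<le> S \<omega>"
          unfolding S_def using J that by (intro member_le_sum) (auto simp: add_nonneg_nonneg)
        finally have "t * \<bar>W j \<omega>\<bar> \<le> ln (S \<omega>)"
          using S_pos by (simp add: ln_ge_iff)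
        then show ?thesis
          using \<open>t > 0\<close> by (simp add: field_simps)
      qed
      moreover have "ln (S \<omega>) / t \<le> (S \<omega> / x - 1 + ln x) / t"
        using \<open>t > 0\<close> \<open>x > 0\<close> S_pos by (intro divide_right_mono ln_le_linear_at) auto
      ultimately show ?thesis
        using J by (intro Max.boundedI) (auto intro: order_trans)
    qed
    have nonneg: "0 \<le> (S \<omega> / x - 1 + ln x) / t" for \<omega>
    proof -
      obtain j where "j \<in> J" using J by auto
      then have "\<bar>W j \<omega>\<bar> \<le> Max ((\<lambda>j. \<bar>W j \<omega>\<bar>) ` J)"
        using J by simp
      then show ?thesis
        using pw[of \<omega>] by linarith
    qed
    have "?E \<le> (\<integral>\<^sup>+\<omega>. ennreal ((S \<omega> / x - 1 + ln x) / t) \<partial>M)"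
      by (intro nn_integral_mono ennreal_leI pw)
    also have "\<dots> = ennreal (expectation (\<lambda>\<omega>. (S \<omega> / x - 1 + ln x) / t))"
      using iS nonneg by (intro nn_integral_eq_integral) auto
    also have "expectation (\<lambda>\<omega>. (S \<omega> / x - 1 + ln x) / t) = (expectation S / x - 1 + ln x) / t"
      using iS by (simp add: prob_space)
    also have "\<dots> \<le> ln x / t"
      using ES \<open>x > 0\<close> \<open>t > 0\<close> by (intro divide_right_mono) (simp_all add: field_simps)
    also have "ln x / t = ln (2 * card J) / t + t * (v / 2)"
      using \<open>t > 0\<close> by (simp add: lnx field_simps power2_eq_square)
    finally show ?thesis
      by (simp add: ennreal_leI)
  qed
  have fin: "?E < \<infinity>"
    using bound[of 1] by (auto simp: le_less_trans top_unique)
  then obtain e where e: "e \<ge> 0" "?E = ennreal e"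
    by (cases ?E) auto
  have "e \<le> 0 + t * (v / 2) + ln (2 * card J) / t" if "t > 0" for t
  proof -
    have "0 \<le> ln (2 * card J) / t + t * (v / 2)"
      using that card \<open>v \<ge> 0\<close> by simp
    then show ?thesis
      using bound[OF that] e by simp
  qed
  then have "e \<le> 0 + 2 * sqrt (v / 2 * ln (2 * card J))"
    using \<open>v \<ge> 0\<close> card by (intro le_two_sqrt_from_weights) auto
  also have "\<dots> = sqrt (2\<^sup>2 * (v / 2 * ln (2 * card J)))"
    by (simp only: real_sqrt_mult[of "2\<^sup>2"] real_sqrt_abs)
  also have "2\<^sup>2 * (v / 2 * ln (2 * card J)) = 2 * v * ln (2 * card J)"
    by simp
  finally show ?thesis
    using e by (simp add: ennreal_leI)
qed

section \<open>Random subsets\<close>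

text \<open>A fair sign is the case p = 1/2 of the inequality behind Hoeffding's lemma, taken over
  an interval of length \<open>2 * y\<close>. The claim is even in \<open>x\<close>, so it suffices
  to treat \<open>y\<close>, the absolute value.\<close>

lemma cosh_le_exp_half_square:
  fixes x :: real
  shows "exp x + exp (- x) \<le> 2 * exp (x\<^sup>2 / 2)"
proof -
  define y where "y = \<bar>x\<bar>"
  have "- (2 * y) * (1 / 2) + ln (1 + 1 / 2 * (exp (2 * y) - 1)) \<le> (2 * y)\<^sup>2 / 8"
    by (intro Hoeffdings_lemma_aux) (auto simp: y_def)
  then have "ln ((1 + exp (2 * y)) / 2) \<le> y + y\<^sup>2 / 2"
    by (simp add: field_simps power2_eq_square)
  moreover have "(1 + exp (2 * y)) / 2 = exp (ln ((1 + exp (2 * y)) / 2))"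
    by (simp add: add_pos_pos)
  ultimately have "(1 + exp (2 * y)) / 2 \<le> exp (y + y\<^sup>2 / 2)"
    by (metis exp_le_cancel_iff)
  then have "exp (- y) * (1 + exp (2 * y)) \<le> exp (- y) * (2 * exp (y + y\<^sup>2 / 2))"
    by (intro mult_left_mono) auto
  then have "exp (- y) + exp y \<le> 2 * exp (y\<^sup>2 / 2)"
    by (simp add: algebra_simps flip: exp_add)
  then show ?thesis
    by (auto simp: y_def abs_if split: if_splits)
qed

abbreviation random_subset :: "'n :: finite set measure"
  where "random_subset \<equiv> measure_pmf (pmf_of_set UNIV)"

text \<open>Expanding the product over \<open>i\<close> of
  \<open>exp (t * c i) + exp (- (t * c i))\<close> gives exactly one summand per subset, so the
  uniform average factorises without any appeal to independence.\<close>

lemma random_subset_mgf: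
  fixes c :: "'n :: finite \<Rightarrow> real"
  shows "(\<integral>\<^sup>+A. ennreal (exp (t * (\<Sum>i\<in>UNIV. if i \<in> A then c i else - c i))) \<partial>random_subset)
    \<le> ennreal (exp (t\<^sup>2 * (\<Sum>i\<in>UNIV. (c i)\<^sup>2) / 2))"
proof -
  define s where "s A = (\<Sum>i\<in>UNIV. if i \<in> A then c i else - c i)" for A
  have split: "exp (t * s A) = (\<Prod>i\<in>A. exp (t * c i)) * (\<Prod>i\<in>UNIV - A. exp (- (t * c i)))" for A
  proof -
    have "s A = (\<Sum>i\<in>A. c i) + (\<Sum>i\<in>UNIV - A. - c i)"
      by (simp add: s_def sum.If_cases Compl_eq_Diff_UNIV)
    then show ?thesis
      by (simp add: exp_add exp_sum exp_diff exp_minus sum_distrib_left sum_negf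
        right_diff_distrib divide_inverse prod_inversef[symmetric])
  qed
  have "(\<Sum>A\<in>UNIV. exp (t * s A)) = (\<Prod>i\<in>UNIV. exp (t * c i) + exp (- (t * c i)))"
    unfolding split by (subst prod_add) simp_all
  also have "\<dots> \<le> (\<Prod>i\<in>UNIV. 2 * exp ((t * c i)\<^sup>2 / 2))"
    by (intro prod_mono conjI cosh_le_exp_half_square) (simp add: add_nonneg_nonneg)
  also have "\<dots> = 2 ^ CARD('n) * exp (\<Sum>i\<in>UNIV. (t * c i)\<^sup>2 / 2)"
    by (simp add: prod.distrib exp_sum)
  also have "(\<Sum>i\<in>UNIV. (t * c i)\<^sup>2 / 2) = t\<^sup>2 * (\<Sum>i\<in>UNIV. (c i)\<^sup>2) / 2"
    by (simp add: sum_divide_distrib sum_distrib_left power_mult_distrib)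
  finally have le: "(\<Sum>A\<in>UNIV. exp (t * s A)) / 2 ^ CARD('n) \<le> exp (t\<^sup>2 * (\<Sum>i\<in>UNIV. (c i)\<^sup>2) / 2)"
    by (simp add: field_simps)
  have "(\<integral>\<^sup>+A. ennreal (exp (t * s A)) \<partial>random_subset) = ennreal ((\<Sum>A\<in>UNIV. exp (t * s A)) / 2 ^ CARD('n))"
    by (simp add: nn_integral_pmf_of_set sum_nonneg divide_ennreal ennreal_power flip: ennreal_numeral)
  with le show ?thesis
    unfolding s_def by (simp add: ennreal_leI)
qed

lemma nn_integral_random_subset_Compl:
  "(\<integral>\<^sup>+A. h (- A) \<partial>random_subset) = (\<integral>\<^sup>+A. h A \<partial>(random_subset :: 'n :: finite set measure))"
proof -
  have "(\<Sum>A\<in>UNIV. h (- A)) = (\<Sum>A\<in>(UNIV :: 'n set set). h A)"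
    by (rule sum.reindex_bij_witness[of _ uminus uminus]) auto
  then show ?thesis
    by (simp add: nn_integral_pmf_of_set)
qed

text \<open>A fold and its complement have the same law, and their sums add up to the full
  sum.\<close>

lemma nn_integral_random_subset_sum:
  fixes c :: "'n :: finite \<Rightarrow> real"
  assumes "\<And>i. c i \<ge> 0"
  shows "(\<integral>\<^sup>+A. ennreal (\<Sum>i\<in>A. c i) \<partial>random_subset) = ennreal ((\<Sum>i\<in>UNIV. c i) / 2)"
proof -
  have "2 * (\<integral>\<^sup>+A. ennreal (\<Sum>i\<in>A. c i) \<partial>random_subset)
      = (\<integral>\<^sup>+A. ennreal (\<Sum>i\<in>A. c i) \<partial>random_subset) + (\<integral>\<^sup>+A. ennreal (\<Sum>i\<in>- A. c i) \<partial>random_subset)"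
    by (simp add: nn_integral_random_subset_Compl[of "\<lambda>A. ennreal (\<Sum>i\<in>A. c i)"] mult_2)
  also have "\<dots> = (\<integral>\<^sup>+A. ennreal (\<Sum>i\<in>A. c i) + ennreal (\<Sum>i\<in>- A. c i) \<partial>(random_subset :: 'n set measure))"
    by (simp add: nn_integral_add)
  also have "\<dots> = (\<integral>\<^sup>+A. ennreal (\<Sum>i\<in>UNIV. c i) \<partial>(random_subset :: 'n set measure))"
  proof (intro nn_integral_cong)
    fix A :: "'n set"
    have "(\<Sum>i\<in>UNIV. c i) = (\<Sum>i\<in>A. c i) + (\<Sum>i\<in>- A. c i)"
      using sum.subset_diff[of A UNIV c] by (simp add: Compl_eq_Diff_UNIV)
    then show "ennreal (\<Sum>i\<in>A. c i) + ennreal (\<Sum>i\<in>- A. c i) = ennreal (\<Sum>i\<in>UNIV. c i)"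
      using assms by (simp add: sum_nonneg flip: ennreal_plus)
  qed
  also have "\<dots> = 2 * ennreal ((\<Sum>i\<in>UNIV. c i) / 2)"
    using assms by (simp add: sum_nonneg measure_pmf.emeasure_space_1 flip: ennreal_mult' ennreal_numeral)
  finally show ?thesis
    by (simp add: ennreal_mult_cancel_left)
qed

section \<open>Joint law of the split and the noise\<close>

context prob_space
begin

text \<open>Every point mass is the probability of an intersection of membership events and
  complements of such events. Independence is given for the events only, so it is first extended to
  the sigma-algebras that they generate.\<close>

lemma distr_random_subset:
  fixes I :: "'a \<Rightarrow> 'n :: finite set"
  assumes [measurable]: "I \<in> measurable M (count_space UNIV)"
    and indep: "indep_events (\<lambda>i. {\<omega> \<in> space M. i \<in> I \<omega>}) UNIV"
    and half: "\<And>i. prob {\<omega> \<in> space M. i \<in> I \<omega>} = 1 / 2"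
  shows "distr M (count_space UNIV) I = random_subset"
proof -
  define F where "F i = {\<omega> \<in> space M. i \<in> I \<omega>}" for i
  have F [measurable]: "F i \<in> events" for i
    unfolding F_def by measurable
  have ind: "indep_sets (\<lambda>i. sigma_sets (space M) {F i}) UNIV"
    using indep unfolding F_def indep_events_def_alt by (intro indep_sets_sigma) (auto simp: Int_stable_def)
  have sub: "{F i, space M - F i} \<subseteq> sigma_sets (space M) {F i}" for i
    by (auto intro: sigma_sets.Basic sigma_sets.Compl)
  have prod: "prob (\<Inter>i\<in>UNIV. G i) = (\<Prod>i\<in>UNIV. prob (G i))"
    if "\<And>i. G i \<in> {F i, space M - F i}" for G
  proof (rule indep_setsD)
    show "\<forall>i\<in>UNIV. G i \<in> sigma_sets (space M) {F i}"
      using that sub by (meson subset_iff)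
  qed (use ind in auto)
  have point: "prob {\<omega> \<in> space M. I \<omega> = A} = 1 / 2 ^ CARD('n)" for A
  proof -
    let ?G = "\<lambda>i. if i \<in> A then F i else space M - F i"
    have "{\<omega> \<in> space M. I \<omega> = A} = (\<Inter>i\<in>UNIV. ?G i)"
    proof (intro set_eqI iffI)
      fix \<omega> assume "\<omega> \<in> (\<Inter>i\<in>UNIV. ?G i)"
      then have G: "\<omega> \<in> ?G i" for i
        by blast
      have "\<omega> \<in> space M"
        \<comment> \<open>Any index will do here; one exists because the index type is
          nonempty.\<close>
        using G[of undefined] by (auto simp: F_def split: if_splits)
      moreover have "i \<in> I \<omega> \<longleftrightarrow> i \<in> A" for i
        using G[of i] by (auto simp: F_def split: if_splits)
      ultimately show "\<omega> \<in> {\<omega> \<in> space M. I \<omega> = A}"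
        by auto
    qed (auto simp: F_def)
    then have "prob {\<omega> \<in> space M. I \<omega> = A} = (\<Prod>i\<in>UNIV. prob (?G i))"
      using prod[of ?G] by auto
    also have "\<dots> = (\<Prod>i\<in>(UNIV :: 'n set). 1 / 2)"
    proof (rule prod.cong)
      fix i
      show "prob (?G i) = 1 / 2"
        using half[of i] F[of i] by (simp add: prob_compl flip: F_def)
    qed simp
    finally show ?thesis
      by (simp add: power_one_over)
  qed
  show ?thesis
  proof (rule measure_eqI_finite[where A = UNIV])
    fix A :: "'n set"
    have "I -` {A} \<inter> space M = {\<omega> \<in> space M. I \<omega> = A}" by auto
    then show "emeasure (distr M (count_space UNIV) I) {A} = emeasure random_subset {A}"
      by (simp add: emeasure_distr emeasure_eq_measure point emeasure_pmf_single)
  qed auto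
qed

text \<open>This removes the underlying probability space: what follows is an average over subsets
  of integrals over a product of normal laws, with the subset fixed inside.\<close>

lemma nn_integral_split_design:
  fixes I :: "'a \<Rightarrow> 'n :: finite set" and \<epsilon> :: "'a \<Rightarrow> real ^ 'n"
  assumes "\<sigma> > 0"
    and eps_indep: "indep_vars (\<lambda>_. borel) (\<lambda>i \<omega>. \<epsilon> \<omega> $ i) UNIV"
    and eps_normal: "\<And>i. distributed M lborel (\<lambda>\<omega>. \<epsilon> \<omega> $ i) (normal_density 0 \<sigma>)"
    and I_indep: "indep_events (\<lambda>i. {\<omega> \<in> space M. i \<in> I \<omega>}) UNIV"
    and I_half: "\<And>i. prob {\<omega> \<in> space M. i \<in> I \<omega>} = 1 / 2"
    and I_eps: "indep_random_variables M (count_space UNIV) I borel \<epsilon>"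
    and h: "\<And>A. h A \<in> borel_measurable (PiM UNIV (\<lambda>_. borel))"
  shows "(\<integral>\<^sup>+\<omega>. h (I \<omega>) (\<lambda>i. \<epsilon> \<omega> $ i) \<partial>M)
    = (\<integral>\<^sup>+A. \<integral>\<^sup>+z. h A z \<partial>PiM UNIV (\<lambda>_. gauss \<sigma>) \<partial>random_subset)"
proof -
  let ?B = "PiM UNIV (\<lambda>_. borel) :: ('n \<Rightarrow> real) measure"
  let ?Z = "PiM UNIV (\<lambda>_. gauss \<sigma>) :: ('n \<Rightarrow> real) measure"
  let ?e = "\<lambda>\<omega> i. \<epsilon> \<omega> $ i"
  have I [measurable]: "I \<in> measurable M (count_space UNIV)" and eps [measurable]: "\<epsilon> \<in> borel_measurable M"
    and ind: "indep_set {I -` S \<inter> space M | S. S \<in> sets (count_space UNIV)} {\<epsilon> -` S \<inter> space M | S. S \<in> sets borel}"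
    using I_eps by (auto simp: indep_random_variables_def)
  have coords [measurable]: "(\<lambda>x i. x $ i) \<in> measurable (borel :: (real ^ 'n) measure) ?B"
    by (intro measurable_PiM_single') auto
  have e [measurable]: "?e \<in> measurable M ?B"
    using measurable_compose[OF eps coords] by simp
  have gauss: "gauss \<sigma> = distr M borel (\<lambda>\<omega>. \<epsilon> \<omega> $ i)" for i
    using distributed_distr_eq_density[OF eps_normal[of i]]
    by (simp add: gauss_def cong: distr_cong)
  have law_e: "distr M ?B ?e = ?Z"
  proof -
    have "distr M ?B (\<lambda>\<omega>. \<lambda>i\<in>UNIV. \<epsilon> \<omega> $ i) = PiM UNIV (\<lambda>i. distr M borel (\<lambda>\<omega>. \<epsilon> \<omega> $ i))"
      using eps_indep by (subst (asm) indep_vars_iff_distr_eq_PiM) auto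
    then show ?thesis
      by (simp add: restrict_def flip: gauss)
  qed
  have law_I: "distr M (count_space UNIV) I = random_subset"
    by (rule distr_random_subset[OF I I_indep I_half])
  interpret Z: prob_space ?Z
    by (intro prob_space_PiM prob_space_gauss assms)
  have joint: "random_subset \<Otimes>\<^sub>M ?Z = distr M (count_space UNIV \<Otimes>\<^sub>M ?B) (\<lambda>\<omega>. (I \<omega>, ?e \<omega>))"
  proof (rule pair_measure_eqI)
    show "sets (random_subset \<Otimes>\<^sub>M ?Z) = sets (distr M (count_space UNIV \<Otimes>\<^sub>M ?B) (\<lambda>\<omega>. (I \<omega>, ?e \<omega>)))"
      unfolding sets_distr by (intro sets_pair_measure_cong sets_PiM_cong) auto
    fix S :: "'n set set" and T assume T: "T \<in> sets ?Z"
    then have T': "T \<in> sets ?B"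
      by (simp add: law_e[symmetric])
    have eT: "?e -` T \<inter> space M = \<epsilon> -` ((\<lambda>x i. x $ i) -` T) \<inter> space M"
      by auto
    have "(\<lambda>x i. x $ i) -` T \<inter> space borel \<in> sets (borel :: (real ^ 'n) measure)"
      using T' by (rule measurable_sets[OF coords])
    then have "prob ((I -` S \<inter> space M) \<inter> (?e -` T \<inter> space M)) = prob (I -` S \<inter> space M) * prob (?e -` T \<inter> space M)"
      unfolding eT by (intro indep_setD[OF ind]) auto
    moreover have "(\<lambda>\<omega>. (I \<omega>, ?e \<omega>)) -` (S \<times> T) \<inter> space M = (I -` S \<inter> space M) \<inter> (?e -` T \<inter> space M)"
      by auto
    moreover have "emeasure random_subset S = prob (I -` S \<inter> space M)"
      unfolding law_I[symmetric] by (simp add: emeasure_distr emeasure_eq_measure)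
    moreover have "emeasure ?Z T = prob (?e -` T \<inter> space M)"
      unfolding law_e[symmetric] using T' by (simp add: emeasure_distr emeasure_eq_measure)
    ultimately show "emeasure random_subset S * emeasure ?Z T
        = emeasure (distr M (count_space UNIV \<Otimes>\<^sub>M ?B) (\<lambda>\<omega>. (I \<omega>, ?e \<omega>))) (S \<times> T)"
      using T' by (simp add: emeasure_distr emeasure_eq_measure ennreal_mult)
  qed (standard | intro prob_space_imp_sigma_finite measure_pmf.prob_space_axioms Z.prob_space_axioms)+
  \<comment> \<open>There are only finitely many subsets, so measurability of each section gives
    joint measurability.\<close>
  have h': "case_prod h \<in> borel_measurable (count_space UNIV \<Otimes>\<^sub>M ?B)"
    using h by (intro measurable_pair_measure_countable1) auto
  have setsZ: "sets ?Z = sets ?B"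
    by (intro sets_PiM_cong) auto
  have "sets (random_subset \<Otimes>\<^sub>M ?Z) = sets (count_space UNIV \<Otimes>\<^sub>M ?B)"
    by (intro sets_pair_measure_cong setsZ) simp
  then have h'': "case_prod h \<in> borel_measurable (random_subset \<Otimes>\<^sub>M ?Z)"
    using h' measurable_cong_sets by blast
  have "(\<integral>\<^sup>+\<omega>. h (I \<omega>) (?e \<omega>) \<partial>M) = (\<integral>\<^sup>+x. case_prod h x \<partial>(random_subset \<Otimes>\<^sub>M ?Z))"
    unfolding joint using h' by (subst nn_integral_distr) auto
  also have "\<dots> = (\<integral>\<^sup>+A. \<integral>\<^sup>+z. h A z \<partial>?Z \<partial>random_subset)"
    using Z.nn_integral_fst[OF h''] by simp
  finally show ?thesis .
qed

end

text \<open>Fubini for the coordinates in \<open>B\<close> against the rest. A bound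
  \<open>G\<close> for the inner integral suffices, and it returns as an integral over all
  coordinates because the law of the remaining ones has mass 1.\<close>

lemma nn_integral_gauss_freeze:
  fixes F G :: "('n :: finite \<Rightarrow> real) \<Rightarrow> ennreal"
  assumes "\<sigma> > 0"
    and F: "F \<in> borel_measurable (PiM UNIV (\<lambda>_. borel))"
    and G: "G \<in> borel_measurable (PiM B (\<lambda>_. borel))"
    and le: "\<And>x. x \<in> space (PiM B (\<lambda>_. borel)) \<Longrightarrow>
      (\<integral>\<^sup>+y. F (merge B (- B) (x, y)) \<partial>PiM (- B) (\<lambda>_. gauss \<sigma>)) \<le> G x"
  shows "(\<integral>\<^sup>+z. F z \<partial>PiM UNIV (\<lambda>_. gauss \<sigma>)) \<le> (\<integral>\<^sup>+z. G (restrict z B) \<partial>PiM UNIV (\<lambda>_. gauss \<sigma>))"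
proof -
  interpret prob_space "gauss \<sigma>" by (rule prob_space_gauss[OF assms(1)])
  interpret product_sigma_finite "\<lambda>_. gauss \<sigma>" by standard
  interpret C: prob_space "PiM (- B) (\<lambda>_. gauss \<sigma>)"
    by (intro prob_space_PiM prob_space_gauss assms)
  have sets: "sets (PiM J (\<lambda>_. gauss \<sigma>)) = sets (PiM J (\<lambda>_. borel))" for J :: "'n set"
    by (intro sets_PiM_cong) auto
  have space: "space (PiM J (\<lambda>_. gauss \<sigma>)) = space (PiM J (\<lambda>_. borel :: real measure))" for J :: "'n set"
    by (rule sets_eq_imp_space_eq[OF sets])
  have fold: "(\<integral>\<^sup>+z. f z \<partial>PiM UNIV (\<lambda>_. gauss \<sigma>))
      = (\<integral>\<^sup>+x. \<integral>\<^sup>+y. f (merge B (- B) (x, y)) \<partial>PiM (- B) (\<lambda>_. gauss \<sigma>) \<partial>PiM B (\<lambda>_. gauss \<sigma>))"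
    if "f \<in> borel_measurable (PiM UNIV (\<lambda>_. borel))" for f :: "_ \<Rightarrow> ennreal"
    using product_nn_integral_fold[of B "- B" f] that measurable_cong_sets[OF sets refl] by auto
  have GB: "(\<lambda>z. G (restrict z B)) \<in> borel_measurable (PiM UNIV (\<lambda>_. borel))"
    by (rule measurable_compose[OF measurable_restrict_subset G]) simp
  have "(\<integral>\<^sup>+z. F z \<partial>PiM UNIV (\<lambda>_. gauss \<sigma>)) \<le> (\<integral>\<^sup>+x. G x \<partial>PiM B (\<lambda>_. gauss \<sigma>))"
    unfolding fold[OF F] by (intro nn_integral_mono le) (simp add: space)
  also have "\<dots> = (\<integral>\<^sup>+x. \<integral>\<^sup>+y. G (restrict (merge B (- B) (x, y)) B)
      \<partial>PiM (- B) (\<lambda>_. gauss \<sigma>) \<partial>PiM B (\<lambda>_. gauss \<sigma>))"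
    by (intro nn_integral_cong) (simp add: space_PiM PiE_restrict C.emeasure_space_1[unfolded space_PiM space_gauss])
  also have "\<dots> = (\<integral>\<^sup>+z. G (restrict z B) \<partial>PiM UNIV (\<lambda>_. gauss \<sigma>))"
    by (rule fold[OF GB, symmetric])
  finally show ?thesis .
qed

section \<open>Constrained least squares and selection\<close>

lemma l1_norm_nonneg: "l1_norm b \<ge> 0"
  by (simp add: l1_norm_def sum_nonneg)

lemma l1_norm_minus_le: "l1_norm (a - b) \<le> l1_norm a + l1_norm b"
  by (simp add: l1_norm_def sum_mono flip: sum.distrib)

lemma l1_norm_eq_0: "l1_norm b \<le> 0 \<Longrightarrow> b = 0"
  using l1_norm_nonneg[of b] by (simp add: l1_norm_def vec_eq_iff sum_nonneg_eq_0_iff order_antisym_conv)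

lemma l1_norm_convex:
  assumes "l1_norm a \<le> K" and "l1_norm b \<le> K" and "0 \<le> s" and "s \<le> 1"
  shows "l1_norm ((1 - s) *\<^sub>R a + s *\<^sub>R b) \<le> K"
proof -
  have "l1_norm ((1 - s) *\<^sub>R a + s *\<^sub>R b) \<le> (1 - s) * l1_norm a + s * l1_norm b"
    unfolding l1_norm_def sum_distrib_left sum.distrib[symmetric]
  proof (intro sum_mono)
    fix j
    show "\<bar>((1 - s) *\<^sub>R a + s *\<^sub>R b) $ j\<bar> \<le> (1 - s) * \<bar>a $ j\<bar> + s * \<bar>b $ j\<bar>"
      using assms(3,4) abs_triangle_ineq[of "(1 - s) * a $ j" "s * b $ j"] by (simp add: abs_mult)
  qed
  also have "\<dots> \<le> (1 - s) * K + s * K"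
    using assms by (intro add_mono mult_left_mono) auto
  finally show ?thesis
    by (simp add: algebra_simps)
qed

lemma l1_norm_dual:
  fixes b :: "real ^ 'p"
  shows "(\<Sum>j\<in>UNIV. b $ j * c j) \<le> l1_norm b * Max (range (\<lambda>j. \<bar>c j\<bar>))"
  unfolding l1_norm_def sum_distrib_right
proof (intro sum_mono)
  fix j
  have "b $ j * c j \<le> \<bar>b $ j\<bar> * \<bar>c j\<bar>"
    by (simp flip: abs_mult)
  also have "\<dots> \<le> \<bar>b $ j\<bar> * Max (range (\<lambda>j. \<bar>c j\<bar>))"
    by (intro mult_left_mono) auto
  finally show "b $ j * c j \<le> \<bar>b $ j\<bar> * Max (range (\<lambda>j. \<bar>c j\<bar>))" .
qed

lemma sum_mult_matrix_vector:
  fixes X :: "real ^ 'p ^ 'n"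
  shows "(\<Sum>i\<in>A. z i * (X *v b) $ i) = (\<Sum>j\<in>UNIV. b $ j * (\<Sum>i\<in>A. z i * X $ i $ j))"
proof -
  have "(\<Sum>i\<in>A. z i * (X *v b) $ i) = (\<Sum>i\<in>A. \<Sum>j\<in>UNIV. b $ j * (z i * X $ i $ j))"
    by (simp add: matrix_vector_mult_def sum_distrib_left mult_ac)
  also have "\<dots> = (\<Sum>j\<in>UNIV. \<Sum>i\<in>A. b $ j * (z i * X $ i $ j))"
    by (rule sum.swap)
  finally show ?thesis
    by (simp add: sum_distrib_left)
qed

text \<open>Duality of the l1 norm and the maximum norm, applied once in each argument. With
  \<open>s\<close> a vector of signs, the maximum is the largest entry of a signed Gram
  matrix.\<close>

lemma bilinear_l1_bound:
  fixes X :: "real ^ 'p ^ 'n"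
  shows "(\<Sum>i\<in>UNIV. s i * (X *v a) $ i * (X *v b) $ i)
    \<le> l1_norm a * l1_norm b * Max (range (\<lambda>(j, k). \<bar>\<Sum>i\<in>UNIV. s i * X $ i $ j * X $ i $ k\<bar>))"
    (is "_ \<le> _ * ?M")
proof -
  let ?c = "\<lambda>j k. \<Sum>i\<in>UNIV. s i * X $ i $ j * X $ i $ k"
  have le: "\<bar>?c j k\<bar> \<le> ?M" for j k
    by (rule Max_ge) (auto intro: image_eqI[of _ _ "(j, k)"])
  have inner: "\<bar>\<Sum>k\<in>UNIV. b $ k * ?c j k\<bar> \<le> l1_norm b * ?M" for j
  proof -
    have "\<bar>\<Sum>k\<in>UNIV. b $ k * ?c j k\<bar> \<le> (\<Sum>k\<in>UNIV. \<bar>b $ k\<bar> * \<bar>?c j k\<bar>)"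
      by (rule order_trans[OF sum_abs]) (simp add: abs_mult)
    also have "\<dots> \<le> l1_norm b * ?M"
      unfolding l1_norm_def sum_distrib_right by (intro sum_mono mult_left_mono le) auto
    finally show ?thesis .
  qed
  have "(\<Sum>i\<in>UNIV. s i * (X *v a) $ i * (X *v b) $ i)
      = (\<Sum>j\<in>UNIV. a $ j * (\<Sum>i\<in>UNIV. s i * (X *v b) $ i * X $ i $ j))"
    using sum_mult_matrix_vector[of "\<lambda>i. s i * (X *v b) $ i" X a UNIV] by (simp add: mult_ac)
  also have "\<dots> = (\<Sum>j\<in>UNIV. a $ j * (\<Sum>k\<in>UNIV. b $ k * ?c j k))"
  proof (intro sum.cong refl arg_cong2[where f = "(*)"])
    fix j
    show "(\<Sum>i\<in>UNIV. s i * (X *v b) $ i * X $ i $ j) = (\<Sum>k\<in>UNIV. b $ k * ?c j k)"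
      using sum_mult_matrix_vector[of "\<lambda>i. s i * X $ i $ j" X b UNIV] by (simp add: mult_ac)
  qed
  also have "\<dots> \<le> (\<Sum>j\<in>UNIV. \<bar>a $ j\<bar> * \<bar>\<Sum>k\<in>UNIV. b $ k * ?c j k\<bar>)"
    by (intro sum_mono) (simp flip: abs_mult)
  also have "\<dots> \<le> (\<Sum>j\<in>UNIV. \<bar>a $ j\<bar> * (l1_norm b * ?M))"
    by (intro sum_mono mult_left_mono inner) auto
  finally show ?thesis
    by (simp add: l1_norm_def sum_distrib_right mult.assoc)
qed

text \<open>Projecting onto a convex set makes an obtuse angle with every direction into the set.\<close>

lemma constrained_ls_error:
  fixes X :: "real ^ 'p ^ 'n"
  assumes min: "is_arg_min (\<lambda>b. \<Sum>i\<in>A. (y i - (X *v b) $ i)\<^sup>2) (\<lambda>b. l1_norm b \<le> K) b"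
    and c: "l1_norm c \<le> K"
    and y: "\<And>i. i \<in> A \<Longrightarrow> y i = (X *v c) $ i + z i"
  shows "(\<Sum>i\<in>A. ((X *v b) $ i - (X *v c) $ i)\<^sup>2) \<le> (\<Sum>i\<in>A. z i * ((X *v b) $ i - (X *v c) $ i))"
proof -
  define h where "h i = (X *v b) $ i - (X *v c) $ i" for i
  define H where "H = (\<Sum>i\<in>A. (h i)\<^sup>2)"
  define R where "R = (\<Sum>i\<in>A. z i * h i)"
  have H: "H \<ge> 0" by (simp add: H_def sum_nonneg)
  \<comment> \<open>Minimality is tested only against the point
    \<open>(1 - s) *\<^sub>R b + s *\<^sub>R c\<close> of the segment to \<open>c\<close>, which is
    feasible by convexity. The gain is of order \<open>s\<close>, the quadratic remainder of order
    \<open>s\<^sup>2\<close>.\<close>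
  have step: "2 * (H - R) \<le> s * H" if s: "0 < s" "s \<le> 1" for s
  proof -
    let ?b = "(1 - s) *\<^sub>R b + s *\<^sub>R c"
    have "l1_norm ?b \<le> K"
      using min c s by (intro l1_norm_convex) (auto simp: is_arg_min_def)
    then have "(\<Sum>i\<in>A. (y i - (X *v b) $ i)\<^sup>2) \<le> (\<Sum>i\<in>A. (y i - (X *v ?b) $ i)\<^sup>2)"
      using min by (auto simp: is_arg_min_def not_less)
    also have "\<dots> = (\<Sum>i\<in>A. (y i - (X *v b) $ i)\<^sup>2 + 2 * s * (z i * h i) - 2 * s * (h i)\<^sup>2 + s\<^sup>2 * (h i)\<^sup>2)"
    proof (rule sum.cong)
      fix i assume "i \<in> A"
      have Xb: "(X *v ?b) $ i = (X *v b) $ i - s * h i"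
        by (simp add: h_def matrix_vector_right_distrib matrix_vector_mult_scaleR algebra_simps)
      have r: "y i - (X *v b) $ i = z i - h i"
        using y[OF \<open>i \<in> A\<close>] by (simp add: h_def)
      have r': "y i - (X *v ?b) $ i = (z i - h i) + s * h i"
        using r Xb by simp
      then show "(y i - (X *v ?b) $ i)\<^sup>2
          = (y i - (X *v b) $ i)\<^sup>2 + 2 * s * (z i * h i) - 2 * s * (h i)\<^sup>2 + s\<^sup>2 * (h i)\<^sup>2"
        unfolding r r' by (simp add: power2_eq_square algebra_simps)
    qed simp
    also have "\<dots> = (\<Sum>i\<in>A. (y i - (X *v b) $ i)\<^sup>2) + 2 * s * R - 2 * s * H + s\<^sup>2 * H"
      by (simp add: H_def R_def sum.distrib sum_subtractf sum_distrib_left)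
    finally have "s * (2 * (H - R)) \<le> s * (s * H)"
      by (simp add: algebra_simps power2_eq_square)
    then show ?thesis
      using s by simp
  qed
  have "H - R \<le> 0 + e" if "e > 0" for e
  proof -
    \<comment> \<open>The cap keeps the point on the segment, and \<open>H + 1\<close> avoids a
      division by zero.\<close>
    define s where "s = min 1 (e / (H + 1))"
    have "0 < s" "s \<le> 1"
      using that H by (auto simp: s_def)
    moreover have "s * H \<le> e / (H + 1) * H"
      using H by (intro mult_right_mono) (auto simp: s_def)
    moreover have "e / (H + 1) * H \<le> e"
      using that H by (simp add: field_simps)
    ultimately show ?thesis
      using step[of s] that by simp
  qed
  then have "H - R \<le> 0"
    by (rule field_le_epsilon)
  then show ?thesis
    by (simp add: H_def R_def h_def)
qed

text \<open>The difference of two feasible vectors has l1 norm at most \<open>2 * L\<close>, so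
  duality pairs the noise with single columns of the design. No condition on the Gram matrix
  enters.\<close>

lemma constrained_ls_error_l1:
  fixes X :: "real ^ 'p ^ 'n"
  assumes min: "is_arg_min (\<lambda>b. \<Sum>i\<in>A. (y i - (X *v b) $ i)\<^sup>2) (\<lambda>b. l1_norm b \<le> K) b"
    and c: "l1_norm c \<le> K" and "K \<le> L"
    and y: "\<And>i. i \<in> A \<Longrightarrow> y i = (X *v c) $ i + z i"
  shows "(\<Sum>i\<in>A. ((X *v b) $ i - (X *v c) $ i)\<^sup>2)
    \<le> 2 * L * Max (range (\<lambda>j. \<bar>\<Sum>i\<in>A. z i * X $ i $ j\<bar>))" (is "_ \<le> _ * ?M")
proof -
  have M: "?M \<ge> 0"
    by (intro order_trans[OF _ Max_ge[of _ "\<bar>\<Sum>i\<in>A. z i * X $ i $ undefined\<bar>"]]) auto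
  have "l1_norm (b - c) \<le> 2 * L"
    using l1_norm_minus_le[of b c] min c \<open>K \<le> L\<close> by (auto simp: is_arg_min_def)
  then have "(\<Sum>i\<in>A. z i * (X *v (b - c)) $ i) \<le> 2 * L * ?M"
    unfolding sum_mult_matrix_vector
    by (intro order_trans[OF l1_norm_dual] mult_right_mono M)
  then show ?thesis
    using constrained_ls_error[OF min c y]
    by (simp add: matrix_vector_mult_diff_distrib)
qed

text \<open>The exponent \<open>3 / 8\<close> is chosen so that \<open>exp (3 / 8 * \<zeta>\<^sup>2)\<close> has mean 2 for a standard normal \<open>\<zeta>\<close>.\<close>

definition noise_bound ::
    "real \<Rightarrow> real \<Rightarrow> 'n set \<Rightarrow> ('n \<Rightarrow> real) \<Rightarrow> (nat \<Rightarrow> 'n \<Rightarrow> real) \<Rightarrow> nat \<Rightarrow> nat \<Rightarrow> ('n \<Rightarrow> real) \<Rightarrow> real"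
  where "noise_bound \<sigma> \<theta> A m w k0 N z =
    \<theta> * (4 * (\<Sum>i\<in>A. (z i)\<^sup>2) + 4 * (\<Sum>i\<in>A. m i * z i) + 2 * (\<Sum>i\<in>A. (m i)\<^sup>2))
    + 8 / 3 * \<sigma>\<^sup>2 / \<theta> *
      ((\<Sum>k\<le>N. exp (3 / 8 * ((\<Sum>i\<in>A. w k i * z i) / (\<sigma> * sqrt (\<Sum>i\<in>A. (w k i)\<^sup>2)))\<^sup>2))
        / (2 * (real N + 1)) - 1 + ln (2 * (real N + 1)))
    - 2 * (\<Sum>i\<in>A. w k0 i * z i)"

text \<open>The candidate 0 bounds the residual of the selected candidate by the observation itself, and the
  subtracted term of candidate \<^term>\<open>k0\<close> is centred once the candidates are frozen.\<close>

lemma selection_error_le: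
  fixes w :: "nat \<Rightarrow> 'n :: finite \<Rightarrow> real"
  assumes "\<sigma> > 0" and "\<theta> > 0" and "k \<le> N" and "k0 \<le> N"
    and min: "\<And>l. l \<le> N \<Longrightarrow> (\<Sum>i\<in>A. (z i - w k i)\<^sup>2) \<le> (\<Sum>i\<in>A. (z i - w l i)\<^sup>2)"
    and w0: "\<And>i. i \<in> A \<Longrightarrow> w 0 i = - m i"
  shows "(\<Sum>i\<in>A. (w k i)\<^sup>2) \<le> (\<Sum>i\<in>A. (w k0 i)\<^sup>2) + noise_bound \<sigma> \<theta> A m w k0 N z"
proof -
  define Z where "Z l = (\<Sum>i\<in>A. w l i * z i)" for l
  define d where "d l = (\<Sum>i\<in>A. (w l i)\<^sup>2)" for l
  define \<zeta> where "\<zeta> l = Z l / (\<sigma> * sqrt (d l))" for l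
  define S where "S = (\<Sum>l\<le>N. exp (3 / 8 * (\<zeta> l)\<^sup>2))"
  have d: "d l \<ge> 0" for l
    by (simp add: d_def sum_nonneg)
  have sq: "(\<Sum>i\<in>A. (z i - w l i)\<^sup>2) = (\<Sum>i\<in>A. (z i)\<^sup>2) - 2 * Z l + d l" for l
    by (simp add: Z_def d_def power2_diff sum.distrib sum_subtractf sum_distrib_left mult_ac)
  have "d k \<le> d k0 + 2 * Z k - 2 * Z k0"
    using min[OF \<open>k0 \<le> N\<close>] by (simp add: sq)
  \<comment> \<open>AM-GM for the factors \<open>sqrt (d k)\<close> and
    \<open>\<sigma> * \<zeta> k\<close> of \<open>Z k\<close>. The factorisation survives
    \<open>d k = 0\<close>, because then all coefficients vanish.\<close>
  moreover have "2 * Z k \<le> \<theta> * d k + \<sigma>\<^sup>2 * (\<zeta> k)\<^sup>2 / \<theta>"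
  proof -
    have "Z k = sqrt (d k) * (\<sigma> * \<zeta> k)"
    proof (cases "d k = 0")
      case True
      then have "\<forall>i\<in>A. w k i = 0"
        by (simp add: d_def sum_nonneg_eq_0_iff)
      then show ?thesis
        using True by (simp add: Z_def)
    next
      case False
      then show ?thesis
        using \<open>\<sigma> > 0\<close> by (simp add: \<zeta>_def)
    qed
    moreover have "2 * (p * q) \<le> \<theta> * p\<^sup>2 + q\<^sup>2 / \<theta>" for p q
    proof -
      have "0 \<le> (\<theta> * p - q)\<^sup>2 / \<theta>"
        using \<open>\<theta> > 0\<close> by simp
      also have "\<dots> = \<theta> * p\<^sup>2 + q\<^sup>2 / \<theta> - 2 * (p * q)"
        using \<open>\<theta> > 0\<close> by (simp add: power2_eq_square field_simps)
      finally show ?thesis by simp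
    qed
    ultimately show ?thesis
      using d[of k] by (metis power_mult_distrib real_sqrt_pow2)
  qed
  moreover have "\<theta> * d k \<le> \<theta> * (4 * (\<Sum>i\<in>A. (z i)\<^sup>2) + 4 * (\<Sum>i\<in>A. m i * z i) + 2 * (\<Sum>i\<in>A. (m i)\<^sup>2))"
  proof (intro mult_left_mono)
    have "d k \<le> (\<Sum>i\<in>A. 2 * (z i)\<^sup>2 + 2 * (z i - w k i)\<^sup>2)"
      unfolding d_def
    proof (intro sum_mono)
      fix i
      have "0 \<le> (z i + (z i - w k i))\<^sup>2" by simp
      then show "(w k i)\<^sup>2 \<le> 2 * (z i)\<^sup>2 + 2 * (z i - w k i)\<^sup>2"
        by (simp add: power2_eq_square algebra_simps)
    qed
    also have "\<dots> = 2 * (\<Sum>i\<in>A. (z i)\<^sup>2) + 2 * (\<Sum>i\<in>A. (z i - w k i)\<^sup>2)"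
      by (simp add: sum.distrib sum_distrib_left)
    also have "\<dots> \<le> 2 * (\<Sum>i\<in>A. (z i)\<^sup>2) + 2 * (\<Sum>i\<in>A. (z i + m i)\<^sup>2)"
      using min[of 0] w0 by simp
    also have "\<dots> = 4 * (\<Sum>i\<in>A. (z i)\<^sup>2) + 4 * (\<Sum>i\<in>A. m i * z i) + 2 * (\<Sum>i\<in>A. (m i)\<^sup>2)"
      by (simp add: power2_sum sum.distrib sum_distrib_left mult_ac)
    finally show "d k \<le> \<dots>" .
  qed (use \<open>\<theta> > 0\<close> in simp)
  \<comment> \<open>The selected \<open>k\<close> depends on \<open>z\<close>, so
    \<open>\<zeta> k\<close> has no usable law; a sum over all candidates dominates its exponential.
    The tangent is taken at \<open>2 * (N + 1)\<close>, which bounds the mean of that sum.\<close>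
  moreover have "\<sigma>\<^sup>2 * (\<zeta> k)\<^sup>2 / \<theta> \<le> 8 / 3 * \<sigma>\<^sup>2 / \<theta> * (S / (2 * (real N + 1)) - 1 + ln (2 * (real N + 1)))"
  proof -
    have S: "exp (3 / 8 * (\<zeta> k)\<^sup>2) \<le> S"
      unfolding S_def using \<open>k \<le> N\<close> by (intro member_le_sum) auto
    then have "S > 0"
      using exp_gt_zero order_less_le_trans by blast
    then have "3 / 8 * (\<zeta> k)\<^sup>2 \<le> ln S"
      using S ln_ge_iff by blast
    also have "\<dots> \<le> S / (2 * (real N + 1)) - 1 + ln (2 * (real N + 1))"
      using \<open>S > 0\<close> by (intro ln_le_linear_at) auto
    finally have "8 / 3 * \<sigma>\<^sup>2 / \<theta> * (3 / 8 * (\<zeta> k)\<^sup>2)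
        \<le> 8 / 3 * \<sigma>\<^sup>2 / \<theta> * (S / (2 * (real N + 1)) - 1 + ln (2 * (real N + 1)))"
      using \<open>\<theta> > 0\<close> by (intro mult_left_mono) auto
    then show ?thesis by simp
  qed
  ultimately have "d k \<le> d k0 + (\<theta> * (4 * (\<Sum>i\<in>A. (z i)\<^sup>2) + 4 * (\<Sum>i\<in>A. m i * z i) + 2 * (\<Sum>i\<in>A. (m i)\<^sup>2))
      + 8 / 3 * \<sigma>\<^sup>2 / \<theta> * (S / (2 * (real N + 1)) - 1 + ln (2 * (real N + 1))) - 2 * Z k0)"
    by linarith
  then show ?thesis
    unfolding noise_bound_def S_def \<zeta>_def Z_def d_def .
qed

text \<open>The linear forms are centred, and each exponential has mean at most 2, so the normalised
  sum minus 1 has nonpositive mean. Only the logarithm survives.\<close>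

lemma integral_noise_bound:
  fixes w :: "nat \<Rightarrow> 'n :: finite \<Rightarrow> real"
  assumes "\<sigma> > 0" and "\<theta> > 0" and "N \<ge> 1"
  shows "integrable (PiM A (\<lambda>_. gauss \<sigma>)) (noise_bound \<sigma> \<theta> A m w k0 N)"
    and "(\<integral>z. noise_bound \<sigma> \<theta> A m w k0 N z \<partial>PiM A (\<lambda>_. gauss \<sigma>))
      \<le> \<theta> * (\<Sum>i\<in>A. 4 * \<sigma>\<^sup>2 + 2 * (m i)\<^sup>2) + 16 / 3 * \<sigma>\<^sup>2 / \<theta> * ln (real N + 1)"
proof -
  interpret prob_space "PiM A (\<lambda>_. gauss \<sigma>)"
    by (intro prob_space_PiM prob_space_gauss assms)
  define e where "e k z = exp (3 / 8 * ((\<Sum>i\<in>A. w k i * z i) / (\<sigma> * sqrt (\<Sum>i\<in>A. (w k i)\<^sup>2)))\<^sup>2)" for k z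
  have e_meas [measurable]: "e k \<in> borel_measurable (PiM A (\<lambda>_. gauss \<sigma>))" for k
    unfolding e_def by measurable
  have e_le: "(\<integral>\<^sup>+z. ennreal (e k z) \<partial>PiM A (\<lambda>_. gauss \<sigma>)) \<le> ennreal 2" for k
    unfolding e_def using gauss_PiM_exp_square[OF \<open>\<sigma> > 0\<close>, of A "w k"] by simp
  have e_int: "integrable (PiM A (\<lambda>_. gauss \<sigma>)) (e k)" for k
    using e_le[of k] by (intro integrableI_nonneg) (auto simp: e_def le_less_trans)
  have e_exp: "expectation (e k) \<le> 2" for k
  proof -
    have "ennreal (expectation (e k)) \<le> ennreal 2"
      using e_le[of k] e_int[of k] by (subst (asm) nn_integral_eq_integral) (auto simp: e_def)
    then show ?thesis
      by (subst (asm) ennreal_le_iff) auto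
  qed
  have z [simp]: "integrable (PiM A (\<lambda>_. gauss \<sigma>)) (\<lambda>z. z i)" "expectation (\<lambda>z. z i) = 0"
      "integrable (PiM A (\<lambda>_. gauss \<sigma>)) (\<lambda>z. (z i)\<^sup>2)" "expectation (\<lambda>z. (z i)\<^sup>2) = \<sigma>\<^sup>2" if "i \<in> A" for i
    using gauss_PiM_coordinate[OF \<open>\<sigma> > 0\<close> that] by (auto simp: has_bochner_integral_iff)
  have nb: "noise_bound \<sigma> \<theta> A m w k0 N = (\<lambda>z.
      \<theta> * (4 * (\<Sum>i\<in>A. (z i)\<^sup>2) + 4 * (\<Sum>i\<in>A. m i * z i) + 2 * (\<Sum>i\<in>A. (m i)\<^sup>2))
      + 8 / 3 * \<sigma>\<^sup>2 / \<theta> * ((\<Sum>k\<le>N. e k z) / (2 * (real N + 1)) - 1 + ln (2 * (real N + 1)))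
      - 2 * (\<Sum>i\<in>A. w k0 i * z i))"
    by (simp add: fun_eq_iff noise_bound_def e_def)
  have i1: "integrable (PiM A (\<lambda>_. gauss \<sigma>)) (\<lambda>z. \<Sum>i\<in>A. (z i)\<^sup>2)"
    and i2: "integrable (PiM A (\<lambda>_. gauss \<sigma>)) (\<lambda>z. \<Sum>i\<in>A. c i * z i)"
    and i3: "integrable (PiM A (\<lambda>_. gauss \<sigma>)) (\<lambda>z. \<Sum>k\<le>N. e k z)" for c
    using e_int by auto
  have v1: "expectation (\<lambda>z. \<Sum>i\<in>A. (z i)\<^sup>2) = (\<Sum>i\<in>A. \<sigma>\<^sup>2)"
    by (subst Bochner_Integration.integral_sum) auto
  have v2: "expectation (\<lambda>z. \<Sum>i\<in>A. c i * z i) = 0" for c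
    by (subst Bochner_Integration.integral_sum) auto
  have v3: "expectation (\<lambda>z. \<Sum>k\<le>N. e k z) \<le> 2 * (real N + 1)"
  proof -
    have "expectation (\<lambda>z. \<Sum>k\<le>N. e k z) = (\<Sum>k\<le>N. expectation (e k))"
      using e_int by (intro Bochner_Integration.integral_sum) auto
    also have "\<dots> \<le> (\<Sum>k\<le>N. 2)"
      by (intro sum_mono e_exp)
    finally show ?thesis by simp
  qed
  show "integrable (PiM A (\<lambda>_. gauss \<sigma>)) (noise_bound \<sigma> \<theta> A m w k0 N)"
    unfolding nb using i1 i2 i3 by auto
  have "expectation (noise_bound \<sigma> \<theta> A m w k0 N)
      = \<theta> * (4 * (\<Sum>i\<in>A. \<sigma>\<^sup>2) + 2 * (\<Sum>i\<in>A. (m i)\<^sup>2))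
      + 8 / 3 * \<sigma>\<^sup>2 / \<theta> * (expectation (\<lambda>z. \<Sum>k\<le>N. e k z) / (2 * (real N + 1)) - 1 + ln (2 * (real N + 1)))"
    unfolding nb using i1 i2 i3 by (simp add: v1 v2 prob_space)
  also have "\<dots> \<le> \<theta> * (4 * (\<Sum>i\<in>A. \<sigma>\<^sup>2) + 2 * (\<Sum>i\<in>A. (m i)\<^sup>2)) + 8 / 3 * \<sigma>\<^sup>2 / \<theta> * (2 * ln (real N + 1))"
  proof (intro add_left_mono mult_left_mono)
    have "expectation (\<lambda>z. \<Sum>k\<le>N. e k z) / (2 * (real N + 1)) \<le> 1"
      using v3 by (simp add: field_simps)
    \<comment> \<open>Here \<open>N \<ge> 1\<close> is indispensable: the mean 2 of one exponential
      is absorbed into a second factor \<open>N + 1\<close>. The result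
      \<open>2 * ln (N + 1)\<close> turns 8/3 into 16/3.\<close>
    moreover have "2 * (real N + 1) \<le> (real N + 1)\<^sup>2"
      unfolding power2_eq_square using \<open>N \<ge> 1\<close> by (intro mult_right_mono) auto
    then have "ln (2 * (real N + 1)) \<le> ln ((real N + 1)\<^sup>2)"
      by (subst ln_le_cancel_iff) auto
    moreover have "ln ((real N + 1)\<^sup>2) = 2 * ln (real N + 1)"
      by (simp add: ln_realpow)
    ultimately show "expectation (\<lambda>z. \<Sum>k\<le>N. e k z) / (2 * (real N + 1)) - 1 + ln (2 * (real N + 1))
        \<le> 2 * ln (real N + 1)"
      by linarith
  qed (use \<open>\<theta> > 0\<close> in auto)
  also have "\<dots> = \<theta> * (\<Sum>i\<in>A. 4 * \<sigma>\<^sup>2 + 2 * (m i)\<^sup>2) + 16 / 3 * \<sigma>\<^sup>2 / \<theta> * ln (real N + 1)"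
    by (simp add: sum.distrib algebra_simps flip: sum_distrib_left)
  finally show "expectation (noise_bound \<sigma> \<theta> A m w k0 N) \<le> \<dots>" .
qed

section \<open>One fold of the cross-validation\<close>

text \<open>Here \<^term>\<open>W\<close> and \<^term>\<open>N\<close> are the candidate errors and the largest candidate index computed from
  the noise on \<^term>\<open>- A\<close>. When \<^prop>\<open>N x = 0\<close> there is nothing to select.\<close>

definition fold_bound ::
    "real \<Rightarrow> real \<Rightarrow> 'n set \<Rightarrow> ('n \<Rightarrow> real) \<Rightarrow> (('n \<Rightarrow> real) \<Rightarrow> nat \<Rightarrow> 'n \<Rightarrow> real) \<Rightarrow> nat
      \<Rightarrow> (('n \<Rightarrow> real) \<Rightarrow> nat) \<Rightarrow> ('n \<Rightarrow> real) \<Rightarrow> real"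
  where "fold_bound \<sigma> \<theta> A m W k0 N z =
    (let x = restrict z (- A) in (\<Sum>i\<in>A. (W x k0 i)\<^sup>2)
      + (if 1 \<le> N x \<and> k0 \<le> N x then noise_bound \<sigma> \<theta> A m (W x) k0 (N x) z else 0))"

lemma fold_error_le:
  fixes W :: "('n :: finite \<Rightarrow> real) \<Rightarrow> nat \<Rightarrow> 'n \<Rightarrow> real"
  assumes "\<sigma> > 0" and "\<theta> > 0" and "k \<le> N (restrict z (- A))" and "k0 \<le> N (restrict z (- A))"
    and "\<And>l. l \<le> N (restrict z (- A)) \<Longrightarrow>
      (\<Sum>i\<in>A. (z i - W (restrict z (- A)) k i)\<^sup>2) \<le> (\<Sum>i\<in>A. (z i - W (restrict z (- A)) l i)\<^sup>2)"
    and "\<And>i. i \<in> A \<Longrightarrow> W (restrict z (- A)) 0 i = - m i"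
  shows "(\<Sum>i\<in>A. (W (restrict z (- A)) k i)\<^sup>2) \<le> fold_bound \<sigma> \<theta> A m W k0 N z"
proof (cases "N (restrict z (- A)) = 0")
  case True
  then have "k = k0" using assms(3,4) by simp
  then show ?thesis
    using True by (simp add: fold_bound_def)
next
  case False
  then have N: "1 \<le> N (restrict z (- A)) \<and> k0 \<le> N (restrict z (- A))"
    using assms(4) by simp
  show ?thesis
    unfolding fold_bound_def Let_def if_P[OF N] by (rule selection_error_le[OF assms])
qed

text \<open>\<open>noise_bound\<close> contains signed terms, so positivity is not visible from its
  form. It holds because some minimiser exists and its squared error is dominated. Thereby the
  nonnegative integral equals the Bochner integral, in which centred terms cancel.\<close>

lemma fold_bound_nonneg:
  fixes W :: "('n :: finite \<Rightarrow> real) \<Rightarrow> nat \<Rightarrow> 'n \<Rightarrow> real"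
  assumes "\<sigma> > 0" and "\<theta> > 0"
    and "\<And>i. i \<in> A \<Longrightarrow> W (restrict z (- A)) 0 i = - m i"
  shows "0 \<le> fold_bound \<sigma> \<theta> A m W k0 N z"
proof (cases "k0 \<le> N (restrict z (- A))")
  case True
  let ?w = "W (restrict z (- A))"
  obtain k where "is_arg_min (\<lambda>l. \<Sum>i\<in>A. (z i - ?w l i)\<^sup>2) (\<lambda>l. l \<in> {..N (restrict z (- A))}) k"
    using ex_is_arg_min_if_finite[of "{..N (restrict z (- A))}"] by auto
  then have "(\<Sum>i\<in>A. (?w k i)\<^sup>2) \<le> fold_bound \<sigma> \<theta> A m W k0 N z"
    using True assms by (intro fold_error_le) (auto simp: is_arg_min_def not_less)
  then show ?thesis
    by (rule order_trans[rotated]) (simp add: sum_nonneg)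
qed (simp add: fold_bound_def sum_nonneg)

lemma measurable_fold_bound:
  fixes W :: "('n :: finite \<Rightarrow> real) \<Rightarrow> nat \<Rightarrow> 'n \<Rightarrow> real"
  assumes W: "\<And>k i. (\<lambda>x. W x k i) \<in> borel_measurable (PiM (- A) (\<lambda>_. borel))"
    and N: "N \<in> measurable (PiM (- A) (\<lambda>_. borel)) (count_space UNIV)"
  shows "fold_bound \<sigma> \<theta> A m W k0 N \<in> borel_measurable (PiM UNIV (\<lambda>_. borel))"
proof -
  have r: "(\<lambda>z. restrict z (- A)) \<in> measurable (PiM UNIV (\<lambda>_. borel)) (PiM (- A) (\<lambda>_. borel :: real measure))"
    by (intro measurable_restrict_subset) simp
  have [measurable]: "(\<lambda>z. W (restrict z (- A)) k i) \<in> borel_measurable (PiM UNIV (\<lambda>_. borel))" for k i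
    by (rule measurable_compose[OF r W])
  have [measurable]: "(\<lambda>z. N (restrict z (- A))) \<in> measurable (PiM UNIV (\<lambda>_. borel)) (count_space UNIV)"
    by (rule measurable_compose[OF r N])
  \<comment> \<open>The number of summands varies with \<open>N\<close>, so measurability is shown
    for each of the countably many values first.\<close>
  have "(\<lambda>z. noise_bound \<sigma> \<theta> A m (W (restrict z (- A))) k0 n z) \<in> borel_measurable (PiM UNIV (\<lambda>_. borel))" for n
    unfolding noise_bound_def by measurable
  then have [measurable]: "(\<lambda>z. noise_bound \<sigma> \<theta> A m (W (restrict z (- A))) k0 (N (restrict z (- A))) z)
      \<in> borel_measurable (PiM UNIV (\<lambda>_. borel))"
    by (rule measurable_compose_countable) measurable
  show ?thesis
    unfolding fold_bound_def Let_def by measurable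
qed

text \<open>Once the noise on \<open>- A\<close> is frozen, the candidates, \<open>N x\<close> and
  the case distinction on \<open>N x\<close> are all constants, so the mean over the noise on
  \<open>A\<close> is that of a fixed \<open>noise_bound\<close>, or of 0.\<close>

lemma nn_integral_fold_bound:
  fixes W :: "('n :: finite \<Rightarrow> real) \<Rightarrow> nat \<Rightarrow> 'n \<Rightarrow> real"
  assumes "\<sigma> > 0" and "\<theta> > 0"
    and W: "\<And>k i. (\<lambda>x. W x k i) \<in> borel_measurable (PiM (- A) (\<lambda>_. borel))"
    and N: "N \<in> measurable (PiM (- A) (\<lambda>_. borel)) (count_space UNIV)"
    and W0: "\<And>x i. x \<in> space (PiM (- A) (\<lambda>_. borel)) \<Longrightarrow> i \<in> A \<Longrightarrow> W x 0 i = - m i"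
  shows "(\<integral>\<^sup>+z. ennreal (fold_bound \<sigma> \<theta> A m W k0 N z) \<partial>PiM UNIV (\<lambda>_. gauss \<sigma>))
    \<le> (\<integral>\<^sup>+z. ennreal (\<Sum>i\<in>A. (W (restrict z (- A)) k0 i)\<^sup>2) \<partial>PiM UNIV (\<lambda>_. gauss \<sigma>))
      + ennreal (\<theta> * (\<Sum>i\<in>A. 4 * \<sigma>\<^sup>2 + 2 * (m i)\<^sup>2))
      + ennreal (16 / 3 * \<sigma>\<^sup>2 / \<theta>) *
        (\<integral>\<^sup>+z. ennreal (ln (real (N (restrict z (- A))) + 1)) \<partial>PiM UNIV (\<lambda>_. gauss \<sigma>))"
proof -
  let ?B = "PiM (- A) (\<lambda>_. borel) :: ('n \<Rightarrow> real) measure"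
  let ?U = "PiM UNIV (\<lambda>_. gauss \<sigma>) :: ('n \<Rightarrow> real) measure"
  interpret U: prob_space ?U
    by (intro prob_space_PiM prob_space_gauss assms)
  interpret A: prob_space "PiM A (\<lambda>_. gauss \<sigma>)"
    by (intro prob_space_PiM prob_space_gauss assms)
  note W [measurable] N [measurable]
  define G0 where "G0 x = (\<Sum>i\<in>A. (W x k0 i)\<^sup>2)" for x
  define c1 where "c1 = \<theta> * (\<Sum>i\<in>A. 4 * \<sigma>\<^sup>2 + 2 * (m i)\<^sup>2)"
  define c2 where "c2 = 16 / 3 * \<sigma>\<^sup>2 / \<theta>"
  define G where "G x = ennreal (G0 x) + ennreal c1 + ennreal c2 * ennreal (ln (real (N x) + 1))" for x
  have c: "c1 \<ge> 0" "c2 \<ge> 0"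
    using assms(2) by (auto simp: c1_def c2_def sum_nonneg)
  have [measurable]: "G0 \<in> borel_measurable ?B"
    unfolding G0_def by measurable
  have G [measurable]: "G \<in> borel_measurable ?B"
    unfolding G_def by measurable
  have "(\<integral>\<^sup>+z. ennreal (fold_bound \<sigma> \<theta> A m W k0 N z) \<partial>?U) \<le> (\<integral>\<^sup>+z. G (restrict z (- A)) \<partial>?U)"
  proof (rule nn_integral_gauss_freeze[OF \<open>\<sigma> > 0\<close> _ G])
    show "(\<lambda>z. ennreal (fold_bound \<sigma> \<theta> A m W k0 N z)) \<in> borel_measurable (PiM UNIV (\<lambda>_. borel))"
      using measurable_fold_bound[OF W N] by measurable
    fix x assume x: "x \<in> space ?B"
    let ?z = "\<lambda>y. merge (- A) (- (- A)) (x, y)"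
    have rz: "restrict (?z y) (- A) = x" for y
      using x by (auto simp: space_PiM PiE_restrict)
    have nz: "noise_bound \<sigma> \<theta> A m w k0 n (?z y) = noise_bound \<sigma> \<theta> A m w k0 n y" for w n y
    proof -
      have "?z y i = y i" if "i \<in> A" for i
        using that by (simp add: merge_def)
      then show ?thesis
        unfolding noise_bound_def by (simp cong: sum.cong)
    qed
    have nonneg: "0 \<le> fold_bound \<sigma> \<theta> A m W k0 N (?z y)" for y
      by (rule fold_bound_nonneg[OF assms(1,2)]) (simp only: rz W0[OF x])
    have fb: "fold_bound \<sigma> \<theta> A m W k0 N (?z y)
        = G0 x + (if 1 \<le> N x \<and> k0 \<le> N x then noise_bound \<sigma> \<theta> A m (W x) k0 (N x) y else 0)" for y
      by (simp only: fold_bound_def Let_def rz nz G0_def)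
    define h where "h y = (if 1 \<le> N x \<and> k0 \<le> N x then noise_bound \<sigma> \<theta> A m (W x) k0 (N x) y else 0)" for y
    have int_h: "integrable (PiM A (\<lambda>_. gauss \<sigma>)) h"
      unfolding h_def using integral_noise_bound(1)[OF assms(1,2), of "N x"]
      by (cases "1 \<le> N x \<and> k0 \<le> N x") auto
    have "A.expectation h \<le> c1 + c2 * ln (real (N x) + 1)"
    proof (cases "1 \<le> N x \<and> k0 \<le> N x")
      case True
      then show ?thesis
        unfolding h_def c1_def c2_def if_P[OF True] by (intro integral_noise_bound(2)[OF assms(1,2)]) simp
    next
      case False
      then show ?thesis
        unfolding h_def if_not_P[OF False] using c by simp
    qed
    then have "A.expectation (\<lambda>y. fold_bound \<sigma> \<theta> A m W k0 N (?z y)) \<le> G0 x + (c1 + c2 * ln (real (N x) + 1))"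
      unfolding fb h_def[symmetric] using int_h by (simp add: A.prob_space)
    moreover have "integrable (PiM A (\<lambda>_. gauss \<sigma>)) (\<lambda>y. fold_bound \<sigma> \<theta> A m W k0 N (?z y))"
      unfolding fb h_def[symmetric] using int_h by simp
    ultimately have "(\<integral>\<^sup>+y. ennreal (fold_bound \<sigma> \<theta> A m W k0 N (?z y)) \<partial>PiM A (\<lambda>_. gauss \<sigma>))
        \<le> ennreal (G0 x + (c1 + c2 * ln (real (N x) + 1)))"
      using nonneg by (subst nn_integral_eq_integral) (auto simp: ennreal_leI)
    also have "\<dots> = G x"
      using c by (simp add: G_def G0_def sum_nonneg ennreal_mult add.assoc)
    finally show "(\<integral>\<^sup>+y. ennreal (fold_bound \<sigma> \<theta> A m W k0 N (?z y)) \<partial>PiM (- (- A)) (\<lambda>_. gauss \<sigma>)) \<le> G x"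
      by simp
  qed
  also have "\<dots> = (\<integral>\<^sup>+z. ennreal (G0 (restrict z (- A))) \<partial>?U) + ennreal c1
      + ennreal c2 * (\<integral>\<^sup>+z. ennreal (ln (real (N (restrict z (- A))) + 1)) \<partial>?U)"
  proof -
    have r: "(\<lambda>z. restrict z (- A)) \<in> measurable ?U ?B"
      by (intro measurable_restrict) auto
    have [measurable]: "(\<lambda>z. G0 (restrict z (- A))) \<in> borel_measurable ?U"
        "(\<lambda>z. N (restrict z (- A))) \<in> measurable ?U (count_space UNIV)"
      by (rule measurable_compose[OF r]; measurable)+
    show ?thesis
      unfolding G_def by (simp add: nn_integral_add nn_integral_cmult U.emeasure_space_1)
  qed
  finally show ?thesis
    by (simp add: G0_def c1_def c2_def)
qed

section \<open>The design and the Lasso candidates\<close>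

locale lasso_design =
  fixes X :: "real ^ 'p ^ 'n" and \<beta>s :: "real ^ 'p" and \<sigma> \<delta> :: real
  assumes sigma: "\<sigma> > 0" and delta: "\<delta> > 0"
begin

definition n :: real where "n = real CARD('n)"
definition p :: real where "p = real CARD('p)"
definition L :: real where "L = l1_norm \<beta>s + \<delta>"
definition M :: real where "M = Max (range (\<lambda>j. (1 / n) * (\<Sum>i\<in>UNIV. (X $ i $ j) ^ 4)))"
definition m :: "'n \<Rightarrow> real" where "m i = (X *v \<beta>s) $ i"
definition k0 :: nat where "k0 = nat \<lceil>l1_norm \<beta>s / \<delta>\<rceil>"
text \<open>The maximum norm of the transposed design applied to the noise, restricted to the rows
  in \<open>B\<close>.\<close>

definition score :: "'n set \<Rightarrow> ('n \<Rightarrow> real) \<Rightarrow> real"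
  where "score B z = Max (range (\<lambda>j. \<bar>\<Sum>i\<in>B. z i * X $ i $ j\<bar>))"
text \<open>The largest entry of the difference between the Gram matrices of the rows in
  \<open>A\<close> and in \<open>- A\<close>.\<close>

definition imbalance :: "'n set \<Rightarrow> real"
  where "imbalance A = Max (range (\<lambda>(j, k). \<bar>\<Sum>i\<in>UNIV. (if i \<in> A then 1 else - 1) * X $ i $ j * X $ i $ k\<bar>))"

lemma n_pos: "n > 0" by (simp add: n_def)

lemma p_ge: "p \<ge> 1" by (simp add: p_def Suc_le_eq)

lemma L_pos: "L > 0"
  using delta l1_norm_nonneg[of \<beta>s] by (simp add: L_def)

lemma k0: "l1_norm \<beta>s \<le> real k0 * \<delta>" "real k0 * \<delta> \<le> L"
proof -
  have "real k0 = of_int \<lceil>l1_norm \<beta>s / \<delta>\<rceil>"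
    using delta l1_norm_nonneg[of \<beta>s] by (simp add: k0_def)
  then have "l1_norm \<beta>s / \<delta> \<le> real k0" "real k0 \<le> l1_norm \<beta>s / \<delta> + 1"
    by linarith+
  then show "l1_norm \<beta>s \<le> real k0 * \<delta>" "real k0 * \<delta> \<le> L"
    using delta by (simp_all add: L_def field_simps)
qed

lemma k0_le: "l1_norm \<beta>s \<le> real N * \<delta> \<Longrightarrow> k0 \<le> N"
  using delta by (simp add: k0_def nat_le_iff ceiling_le_iff field_simps)

lemma fourth_moment_le: "(\<Sum>i\<in>UNIV. (X $ i $ j) ^ 4) \<le> n * M"
proof -
  have "(1 / n) * (\<Sum>i\<in>UNIV. (X $ i $ j) ^ 4) \<le> M"
    unfolding M_def by (rule Max_ge) auto
  then show ?thesis
    using n_pos by (simp add: field_simps)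
qed

lemma M_nonneg: "M \<ge> 0"
proof -
  have "0 \<le> (\<Sum>i\<in>UNIV. (X $ i $ undefined) ^ 4)"
    by (intro sum_nonneg) auto
  then have "0 \<le> n * M"
    using fourth_moment_le order_trans by blast
  then show ?thesis
    using n_pos by (simp add: zero_le_mult_iff)
qed

lemma column_sq_le: "(\<Sum>i\<in>UNIV. (X $ i $ j)\<^sup>2) \<le> n * sqrt M"
proof -
  have "(\<Sum>i\<in>UNIV. (X $ i $ j)\<^sup>2)\<^sup>2 \<le> (\<Sum>i\<in>(UNIV :: 'n set). 1\<^sup>2) * (\<Sum>i\<in>UNIV. ((X $ i $ j)\<^sup>2)\<^sup>2)"
    using Cauchy_Schwarz_ineq_sum[of "\<lambda>_. 1" "\<lambda>i. (X $ i $ j)\<^sup>2" UNIV] by simp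
  also have "\<dots> \<le> n * (n * M)"
    using fourth_moment_le[of j] n_pos by (simp add: n_def)
  also have "\<dots> = (n * sqrt M)\<^sup>2"
    using M_nonneg by (simp add: power2_eq_square mult_ac)
  finally show ?thesis
    by (rule power2_le_imp_le) (use n_pos M_nonneg in simp)
qed

lemma column_product_sq_le: "(\<Sum>i\<in>UNIV. (X $ i $ j * X $ i $ k)\<^sup>2) \<le> n * M"
proof -
  have "(\<Sum>i\<in>UNIV. (X $ i $ j * X $ i $ k)\<^sup>2) \<le> (\<Sum>i\<in>UNIV. ((X $ i $ j) ^ 4 + (X $ i $ k) ^ 4) / 2)"
  proof (intro sum_mono)
    fix i
    have "0 \<le> ((X $ i $ j)\<^sup>2 - (X $ i $ k)\<^sup>2)\<^sup>2" by simp
    then show "(X $ i $ j * X $ i $ k)\<^sup>2 \<le> ((X $ i $ j) ^ 4 + (X $ i $ k) ^ 4) / 2"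
      by (simp add: power2_diff power_mult_distrib flip: power_mult)
  qed
  also have "\<dots> \<le> n * M"
    using fourth_moment_le[of j] fourth_moment_le[of k]
    by (simp add: sum.distrib flip: sum_divide_distrib)
  finally show ?thesis .
qed

text \<open>A self-bounding argument: duality bounds \<open>S\<close> by the correlations of
  \<open>m\<close> with the columns, and Cauchy-Schwarz bounds these by \<open>sqrt S\<close> again;
  one factor \<open>sqrt S\<close> then cancels.\<close>

lemma signal_sq_le: "(\<Sum>i\<in>UNIV. (m i)\<^sup>2) \<le> n * (L\<^sup>2 * sqrt M)"
proof -
  let ?c = "\<lambda>j. \<Sum>i\<in>UNIV. m i * X $ i $ j"
  define S where "S = (\<Sum>i\<in>UNIV. (m i)\<^sup>2)"
  have c: "\<bar>?c j\<bar> \<le> sqrt S * sqrt (n * sqrt M)" for j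
  proof -
    have "(?c j)\<^sup>2 \<le> S * (n * sqrt M)"
      unfolding S_def
      by (intro order_trans[OF Cauchy_Schwarz_ineq_sum] mult_left_mono column_sq_le sum_nonneg) auto
    then have "sqrt ((?c j)\<^sup>2) \<le> sqrt (S * (n * sqrt M))"
      by (rule real_sqrt_le_mono)
    then show ?thesis
      by (simp add: real_sqrt_mult)
  qed
  have "S = (\<Sum>j\<in>UNIV. \<beta>s $ j * ?c j)"
    using sum_mult_matrix_vector[of m X \<beta>s UNIV] by (simp add: S_def m_def power2_eq_square)
  also have "\<dots> \<le> l1_norm \<beta>s * Max (range (\<lambda>j. \<bar>?c j\<bar>))"
    by (rule l1_norm_dual)
  also have "\<dots> \<le> L * (sqrt S * sqrt (n * sqrt M))"
    using c delta l1_norm_nonneg[of \<beta>s] by (intro mult_mono) (auto simp: L_def Max_ge_iff)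
  finally have le: "S \<le> L * (sqrt S * sqrt (n * sqrt M))" .
  have S: "S \<ge> 0"
    by (simp add: S_def sum_nonneg)
  have "S \<le> n * (L\<^sup>2 * sqrt M)"
  proof (cases "S = 0")
    case True
    then show ?thesis using n_pos M_nonneg by simp
  next
    case False
    with S have "sqrt S > 0" by simp
    moreover have "sqrt S * sqrt S \<le> sqrt S * (L * sqrt (n * sqrt M))"
      using le S by (simp add: mult_ac)
    ultimately have "sqrt S \<le> L * sqrt (n * sqrt M)"
      using mult_le_cancel_left_pos by blast
    then have "(sqrt S)\<^sup>2 \<le> (L * sqrt (n * sqrt M))\<^sup>2"
      by (rule power_mono) (use S in simp)
    then show ?thesis
      using S n_pos M_nonneg by (simp add: power_mult_distrib mult_ac)
  qed
  then show ?thesis by (simp add: S_def)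
qed

lemma score_nonneg: "score B z \<ge> 0"
  unfolding score_def by (intro order_trans[OF _ Max_ge[of _ "\<bar>\<Sum>i\<in>B. z i * X $ i $ undefined\<bar>"]]) auto

lemma imbalance_ge: "\<bar>\<Sum>i\<in>UNIV. (if i \<in> A then 1 else - 1) * X $ i $ j * X $ i $ k\<bar> \<le> imbalance A"
  unfolding imbalance_def by (rule Max_ge) (auto intro: image_eqI[of _ _ "(j, k)"])

lemma imbalance_nonneg: "imbalance A \<ge> 0"
  using imbalance_ge[of A undefined undefined] by linarith

lemma imbalance_Compl: "imbalance (- A) = imbalance A"
proof -
  have "\<bar>\<Sum>i\<in>UNIV. (if i \<in> - A then 1 else - 1) * X $ i $ j * X $ i $ k\<bar>
      = \<bar>\<Sum>i\<in>UNIV. (if i \<in> A then 1 else - 1) * X $ i $ j * X $ i $ k\<bar>" for j k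
  proof -
    have "(\<Sum>i\<in>UNIV. (if i \<in> - A then 1 else - 1) * X $ i $ j * X $ i $ k)
        = (\<Sum>i\<in>UNIV. - ((if i \<in> A then 1 else - 1) * X $ i $ j * X $ i $ k))"
      by (intro sum.cong) auto
    then show ?thesis
      by (simp add: sum_negf)
  qed
  then show ?thesis
    by (simp add: imbalance_def)
qed

lemma measurable_score [measurable]: "score B \<in> borel_measurable (PiM UNIV (\<lambda>_. borel))"
  unfolding score_def by measurable

text \<open>Uniform in \<open>B\<close>: rows outside \<open>B\<close> receive coefficient 0, which
  only lowers the variance. One lemma thus serves both folds and the full sample.\<close>

lemma expectation_score:
  "(\<integral>\<^sup>+z. ennreal (score B z) \<partial>PiM UNIV (\<lambda>_. gauss \<sigma>)) \<le> ennreal (\<sigma> * root 4 M * sqrt (2 * n * ln (2 * p)))"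
proof -
  interpret prob_space "PiM (UNIV :: 'n set) (\<lambda>_. gauss \<sigma>)"
    by (intro prob_space_PiM prob_space_gauss sigma)
  define v where "v = \<sigma>\<^sup>2 * (n * sqrt M)"
  have v: "v \<ge> 0" using n_pos M_nonneg by (simp add: v_def)
  have "(\<integral>\<^sup>+z. ennreal (Max ((\<lambda>j. \<bar>\<Sum>i\<in>B. z i * X $ i $ j\<bar>) ` UNIV)) \<partial>PiM UNIV (\<lambda>_. gauss \<sigma>))
      \<le> ennreal (sqrt (2 * v * ln (2 * CARD('p))))"
  proof (rule expectation_Max_subgaussian)
    fix j t
    let ?c = "\<lambda>i. if i \<in> B then X $ i $ j else 0"
    have Z: "(\<Sum>i\<in>B. z i * X $ i $ j) = (\<Sum>i\<in>UNIV. ?c i * z i)" for z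
      by (intro sum.mono_neutral_cong_left) (auto simp: mult_ac)
    have "(\<Sum>i\<in>UNIV. (?c i)\<^sup>2) \<le> n * sqrt M"
      by (intro order_trans[OF sum_mono column_sq_le[of j]]) auto
    then have "t\<^sup>2 * \<sigma>\<^sup>2 * (\<Sum>i\<in>UNIV. (?c i)\<^sup>2) / 2 \<le> t\<^sup>2 * v / 2"
      unfolding v_def mult.assoc by (intro divide_right_mono mult_left_mono) auto
    then show "(\<integral>\<^sup>+z. ennreal (exp (t * (\<Sum>i\<in>B. z i * X $ i $ j))) \<partial>PiM UNIV (\<lambda>_. gauss \<sigma>))
        \<le> ennreal (exp (t\<^sup>2 * v / 2))"
      unfolding Z by (subst gauss_PiM_mgf[OF sigma]) (auto intro: ennreal_leI)
  qed (use v in auto)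
  also have "sqrt (2 * v * ln (2 * CARD('p))) = \<sigma> * root 4 M * sqrt (2 * n * ln (2 * p))"
  proof -
    have "root 4 M = sqrt (sqrt M)"
      using real_root_mult_exp[of 2 2 M] by (simp add: sqrt_def)
    moreover have "2 * v * ln (2 * CARD('p)) = \<sigma>\<^sup>2 * (sqrt M * (2 * n * ln (2 * p)))"
      by (simp add: v_def p_def)
    then have "sqrt (2 * v * ln (2 * CARD('p))) = \<sigma> * (sqrt (sqrt M) * sqrt (2 * n * ln (2 * p)))"
      using sigma by (simp only: real_sqrt_mult[of "\<sigma>\<^sup>2"] real_sqrt_mult[of "sqrt M"] real_sqrt_abs abs_of_pos)
    ultimately show ?thesis
      by simp
  qed
  finally show ?thesis
    by (simp add: score_def)
qed

text \<open>For each pair of columns the entry is a Rademacher sum with variance at most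
  \<open>n * M\<close>, the reason for fourth moments. Passing from pairs to columns costs a factor
  2 in the logarithm, as \<open>2 * p\<^sup>2 \<le> (2 * p)\<^sup>2\<close>.\<close>

lemma expectation_imbalance:
  "(\<integral>\<^sup>+A. ennreal (imbalance A) \<partial>random_subset) \<le> ennreal (2 * sqrt M * sqrt (n * ln (2 * p)))"
proof -
  define c where "c jk i = X $ i $ fst jk * X $ i $ snd jk" for jk :: "'p \<times> 'p" and i
  have "(\<integral>\<^sup>+A. ennreal (Max ((\<lambda>jk. \<bar>\<Sum>i\<in>UNIV. if i \<in> A then c jk i else - c jk i\<bar>) ` UNIV)) \<partial>random_subset)
      \<le> ennreal (sqrt (2 * (n * M) * ln (2 * CARD('p \<times> 'p))))"
  proof (rule prob_space.expectation_Max_subgaussian[OF measure_pmf.prob_space_axioms])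
    fix jk t
    have "(\<Sum>i\<in>UNIV. (c jk i)\<^sup>2) \<le> n * M"
      unfolding c_def by (rule column_product_sq_le)
    then have "t\<^sup>2 * (\<Sum>i\<in>UNIV. (c jk i)\<^sup>2) / 2 \<le> t\<^sup>2 * (n * M) / 2"
      by (intro divide_right_mono mult_left_mono) auto
    then show "(\<integral>\<^sup>+A. ennreal (exp (t * (\<Sum>i\<in>UNIV. if i \<in> A then c jk i else - c jk i))) \<partial>random_subset)
        \<le> ennreal (exp (t\<^sup>2 * (n * M) / 2))"
      by (intro order_trans[OF random_subset_mgf]) (auto intro: ennreal_leI)
  qed (use n_pos M_nonneg in auto)
  also have "(\<lambda>A. Max ((\<lambda>jk. \<bar>\<Sum>i\<in>UNIV. if i \<in> A then c jk i else - c jk i\<bar>) ` UNIV)) = imbalance"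
  proof
    fix A
    have "(\<Sum>i\<in>UNIV. if i \<in> A then c jk i else - c jk i)
        = (\<Sum>i\<in>UNIV. (if i \<in> A then 1 else - 1) * X $ i $ fst jk * X $ i $ snd jk)" for jk
      by (intro sum.cong) (auto simp: c_def)
    then show "Max ((\<lambda>jk. \<bar>\<Sum>i\<in>UNIV. if i \<in> A then c jk i else - c jk i\<bar>) ` UNIV) = imbalance A"
      by (simp add: imbalance_def case_prod_beta)
  qed
  also have "sqrt (2 * (n * M) * ln (2 * CARD('p \<times> 'p))) \<le> 2 * sqrt M * sqrt (n * ln (2 * p))"
  proof -
    have "ln (2 * CARD('p \<times> 'p)) \<le> ln ((2 * p)\<^sup>2)"
      using p_ge by (subst ln_le_cancel_iff) (auto simp: p_def power2_eq_square)
    also have "\<dots> = 2 * ln (2 * p)"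
      using ln_realpow[of "2 * p" 2] p_ge by simp
    finally have "2 * (n * M) * ln (2 * CARD('p \<times> 'p)) \<le> 2 * (n * M) * (2 * ln (2 * p))"
      using n_pos M_nonneg by (intro mult_left_mono) auto
    also have "\<dots> = 2\<^sup>2 * (M * (n * ln (2 * p)))"
      by simp
    finally have "sqrt (2 * (n * M) * ln (2 * CARD('p \<times> 'p))) \<le> sqrt (2\<^sup>2 * (M * (n * ln (2 * p))))"
      by (rule real_sqrt_le_mono)
    then show ?thesis
      by (simp only: real_sqrt_mult[of "2\<^sup>2"] real_sqrt_mult[of M] real_sqrt_abs)
  qed
  finally show ?thesis
    by (simp add: ennreal_leI)
qed

text \<open>Passing from the training half to the other half costs a Rademacher sum of the squared errors; the
  squares of \<^term>\<open>m\<close> in it cancel between the two halves.\<close>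

lemma swap_halves_le:
  assumes a: "l1_norm a \<le> L" and b: "l1_norm b \<le> L"
  shows "(\<Sum>i\<in>A. ((X *v a) $ i - m i)\<^sup>2) + (\<Sum>i\<in>- A. ((X *v b) $ i - m i)\<^sup>2)
    \<le> (\<Sum>i\<in>- A. ((X *v a) $ i - m i)\<^sup>2) + (\<Sum>i\<in>A. ((X *v b) $ i - m i)\<^sup>2) + 6 * L\<^sup>2 * imbalance A"
proof -
  define s where "s i = (if i \<in> A then 1 else - 1 :: real)" for i
  have split: "(\<Sum>i\<in>A. f i) - (\<Sum>i\<in>- A. f i) = (\<Sum>i\<in>UNIV. s i * f i)" for f :: "'n \<Rightarrow> real"
  proof -
    have "(\<Sum>i\<in>UNIV. s i * f i) = (\<Sum>i\<in>UNIV. if i \<in> A then f i else - f i)"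
      by (intro sum.cong) (auto simp: s_def)
    then show ?thesis
      by (simp add: sum.If_cases sum_negf)
  qed
  have betas: "l1_norm \<beta>s \<le> L"
    using delta by (simp add: L_def)
  have bil: "\<bar>\<Sum>i\<in>UNIV. s i * (X *v u) $ i * (X *v w) $ i\<bar> \<le> L\<^sup>2 * imbalance A"
    if "l1_norm u \<le> L" "l1_norm w \<le> L" for u w
  proof -
    have le: "(\<Sum>i\<in>UNIV. (if i \<in> B then 1 else - 1) * (X *v u) $ i * (X *v w) $ i) \<le> L\<^sup>2 * imbalance A"
      if B: "imbalance B = imbalance A" for B
    proof -
      have "(\<Sum>i\<in>UNIV. (if i \<in> B then 1 else - 1) * (X *v u) $ i * (X *v w) $ i)
          \<le> l1_norm u * l1_norm w * imbalance B"
        unfolding imbalance_def by (rule bilinear_l1_bound)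
      also have "\<dots> \<le> L * L * imbalance A"
        unfolding B using \<open>l1_norm u \<le> L\<close> \<open>l1_norm w \<le> L\<close> l1_norm_nonneg[of u] l1_norm_nonneg[of w] L_pos imbalance_nonneg
        by (intro mult_right_mono mult_mono) auto
      finally show ?thesis by (simp add: power2_eq_square)
    qed
    \<comment> \<open>\<open>bilinear_l1_bound\<close> is one-sided; complementing the subset flips
      all signs and supplies the other side.\<close>
    have "(\<Sum>i\<in>UNIV. (if i \<in> - A then 1 else - 1) * (X *v u) $ i * (X *v w) $ i)
        = (\<Sum>i\<in>UNIV. - (s i * (X *v u) $ i * (X *v w) $ i))"
      by (intro sum.cong) (auto simp: s_def)
    then have "- (\<Sum>i\<in>UNIV. s i * (X *v u) $ i * (X *v w) $ i) \<le> L\<^sup>2 * imbalance A"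
      using le[OF imbalance_Compl] by (simp add: sum_negf)
    moreover have "(\<Sum>i\<in>UNIV. s i * (X *v u) $ i * (X *v w) $ i) \<le> L\<^sup>2 * imbalance A"
      using le[OF refl] by (simp add: s_def)
    ultimately show ?thesis by linarith
  qed
  let ?q = "\<lambda>u w. \<Sum>i\<in>UNIV. s i * (X *v u) $ i * (X *v w) $ i"
  have "(\<Sum>i\<in>UNIV. s i * ((X *v a) $ i - m i)\<^sup>2) - (\<Sum>i\<in>UNIV. s i * ((X *v b) $ i - m i)\<^sup>2)
      = ?q a a - 2 * ?q a \<beta>s - ?q b b + 2 * ?q b \<beta>s"
    by (simp add: m_def power2_diff power2_eq_square algebra_simps sum.distrib sum_subtractf sum_distrib_left)
  \<comment> \<open>Two diagonal forms with coefficient 1 and two mixed forms with coefficient 2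
    make 6.\<close>
  also have "\<dots> \<le> 6 * (L\<^sup>2 * imbalance A)"
    using bil[OF a a] bil[OF a betas] bil[OF b b] bil[OF b betas] by linarith
  finally show ?thesis
    unfolding split[symmetric] by simp
qed

end

section \<open>Lasso candidates trained on one half\<close>

text \<open>\<open>A\<close> is the half on which candidates are compared, and they are computed
  from \<open>- A\<close>. Cross-validation uses the locale twice: for \<open>I\<close> with
  \<open>g2\<close> and \<open>f1\<close>, and for the complement of \<open>I\<close> with
  \<open>g1\<close> and \<open>f2\<close>.\<close>

locale lasso_fold = lasso_design X \<beta>s \<sigma> \<delta>
  for X :: "real ^ 'p ^ 'n" and \<beta>s :: "real ^ 'p" and \<sigma> \<delta> :: real +
  fixes g :: "'n set \<Rightarrow> ('n \<Rightarrow> real) \<Rightarrow> real \<Rightarrow> real ^ 'p"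
    and f :: "'n set \<Rightarrow> ('n \<Rightarrow> real) \<Rightarrow> nat"
  assumes rule: "lasso_rule X g"
    and f: "\<And>A. f A \<in> measurable (PiM A (\<lambda>_. borel)) (count_space UNIV)"
begin

definition obs :: "'n set \<Rightarrow> ('n \<Rightarrow> real) \<Rightarrow> 'n \<Rightarrow> real"
  where "obs B x = restrict (\<lambda>i. m i + x i) B"

definition est :: "'n set \<Rightarrow> ('n \<Rightarrow> real) \<Rightarrow> nat \<Rightarrow> real ^ 'p"
  where "est A x k = g (- A) (obs (- A) x) (real k * \<delta>)"

definition err :: "'n set \<Rightarrow> ('n \<Rightarrow> real) \<Rightarrow> nat \<Rightarrow> 'n \<Rightarrow> real"
  where "err A x k i = (X *v est A x k) $ i - m i"

definition levels :: "'n set \<Rightarrow> ('n \<Rightarrow> real) \<Rightarrow> nat"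
  where "levels A x = f (- A) (obs (- A) x)"

definition bound :: "real \<Rightarrow> 'n set \<Rightarrow> ('n \<Rightarrow> real) \<Rightarrow> real"
  where "bound \<theta> A z = fold_bound \<sigma> \<theta> A m (err A) k0 (levels A) z"

lemma obs_space: "obs B x \<in> space (PiM B (\<lambda>_. borel))"
  by (simp add: obs_def space_PiM)

lemma obs_restrict: "obs B (restrict z B) = obs B z"
  by (auto simp: obs_def restrict_def)

lemma measurable_obs: "obs B \<in> measurable (PiM B (\<lambda>_. borel)) (PiM B (\<lambda>_. borel))"
  unfolding obs_def by (intro measurable_restrict) measurable

lemma est_min:
  "is_arg_min (\<lambda>b. \<Sum>i\<in>- A. (obs (- A) x i - (X *v b) $ i)\<^sup>2) (\<lambda>b. l1_norm b \<le> real k * \<delta>) (est A x k)"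
  using rule obs_space[of "- A" x] delta by (auto simp: lasso_rule_def est_def)

lemma l1_norm_est: "l1_norm (est A x k) \<le> real k * \<delta>"
  using est_min[of A x k] by (simp add: is_arg_min_def)

lemma err_0: "err A x 0 i = - m i"
  using l1_norm_est[of A x 0] l1_norm_eq_0[of "est A x 0"] by (simp add: err_def)

lemma measurable_err: "(\<lambda>x. err A x k i) \<in> borel_measurable (PiM (- A) (\<lambda>_. borel))"
proof -
  have g: "(\<lambda>y. g (- A) y (real k * \<delta>)) \<in> borel_measurable (PiM (- A) (\<lambda>_. borel))"
    using rule delta by (auto simp: lasso_rule_def)
  have lin: "(\<lambda>b. (X *v b) $ i) \<in> borel_measurable borel"
    by (intro borel_measurable_continuous_onI continuous_intros matrix_vector_mult_linear_continuous_on)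
  show ?thesis
    unfolding err_def est_def
    by (intro borel_measurable_diff measurable_compose[OF measurable_obs measurable_compose[OF g lin]]) auto
qed

lemma measurable_levels: "levels A \<in> measurable (PiM (- A) (\<lambda>_. borel)) (count_space UNIV)"
  unfolding levels_def by (rule measurable_compose[OF measurable_obs f])

lemma measurable_levels_restrict:
  "(\<lambda>z. levels A (restrict z (- A))) \<in> measurable (PiM UNIV (\<lambda>_. borel)) (count_space UNIV)"
  by (rule measurable_compose[OF measurable_restrict_subset measurable_levels]) simp

lemma measurable_bound: "bound \<theta> A \<in> borel_measurable (PiM UNIV (\<lambda>_. borel))"
  unfolding bound_def by (rule measurable_fold_bound[OF measurable_err measurable_levels])

lemma bound_nonneg: "\<theta> > 0 \<Longrightarrow> bound \<theta> A z \<ge> 0"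
  unfolding bound_def using sigma by (intro fold_bound_nonneg err_0)

text \<open>At index \<open>k0\<close> the true vector is feasible on the training half, while the
  level still does not exceed \<open>L\<close>.\<close>

lemma err_in_sample:
  "(\<Sum>i\<in>- A. (err A (restrict z (- A)) k0 i)\<^sup>2) \<le> 2 * L * score (- A) z"
  unfolding err_def score_def m_def
  using k0 by (intro constrained_ls_error_l1[OF est_min]) (auto simp: obs_def m_def)

lemma nn_integral_bound:
  assumes "\<theta> > 0"
  shows "(\<integral>\<^sup>+z. ennreal (bound \<theta> A z) \<partial>PiM UNIV (\<lambda>_. gauss \<sigma>))
    \<le> (\<integral>\<^sup>+z. ennreal (\<Sum>i\<in>A. (err A (restrict z (- A)) k0 i)\<^sup>2) \<partial>PiM UNIV (\<lambda>_. gauss \<sigma>))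
      + ennreal (\<theta> * (\<Sum>i\<in>A. 4 * \<sigma>\<^sup>2 + 2 * (m i)\<^sup>2))
      + ennreal (16 / 3 * \<sigma>\<^sup>2 / \<theta>) *
        (\<integral>\<^sup>+z. ennreal (ln (real (levels A (restrict z (- A))) + 1)) \<partial>PiM UNIV (\<lambda>_. gauss \<sigma>))"
  unfolding bound_def
  by (rule nn_integral_fold_bound[OF sigma assms measurable_err measurable_levels]) (rule err_0)

end

section \<open>Prediction error\<close>

lemma power2_norm_vec: "(norm (v :: real ^ 'n))\<^sup>2 = (\<Sum>i\<in>UNIV. (v $ i)\<^sup>2)"
  by (simp add: norm_vec_def L2_set_def sum_nonneg)

lemma sum_UNIV_split: "(\<Sum>i\<in>UNIV. h i) = (\<Sum>i\<in>A. h i) + (\<Sum>i\<in>- (A :: 'n :: finite set). h i :: real)"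
  using sum.subset_diff[of A UNIV h] by (simp add: Compl_eq_Diff_UNIV)

locale cv_lasso = lasso_design X \<beta>s \<sigma> \<delta>
    + s1: lasso_fold X \<beta>s \<sigma> \<delta> g2 f1 + s2: lasso_fold X \<beta>s \<sigma> \<delta> g1 f2
  for X :: "real ^ 'p ^ 'n" and \<beta>s :: "real ^ 'p" and \<sigma> \<delta> :: real
    and g1 g2 :: "'n set \<Rightarrow> ('n \<Rightarrow> real) \<Rightarrow> real \<Rightarrow> real ^ 'p"
    and f1 f2 :: "'n set \<Rightarrow> ('n \<Rightarrow> real) \<Rightarrow> nat"
begin

text \<open>The weights come from \<^prop>\<open>(2 * a + b)\<^sup>2 \<le> 24 / 5 * a\<^sup>2 + 6 * b\<^sup>2\<close>.\<close>

definition total :: "real \<Rightarrow> real \<Rightarrow> 'n set \<Rightarrow> ('n \<Rightarrow> real) \<Rightarrow> real"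
  where "total \<theta>1 \<theta>2 A z =
    24 / 5 * (s1.bound \<theta>1 A z + s2.bound \<theta>2 (- A) z) + 12 * L * score UNIV z"

text \<open>Deterministic, for a fixed split. The triangle inequality passes through
  \<open>\<mu>\<close> on the way to \<open>c\<close> and again on the way to \<open>b\<close>,
  which gives \<open>2 * d + r\<close>.\<close>

lemma prediction_error_le:
  assumes "\<theta>1 > 0" and "\<theta>2 > 0"
    and Y: "\<And>i. Y $ i = m i + z i"
    and k1: "k1 \<le> s1.levels A (restrict z (- A))" "k0 \<le> s1.levels A (restrict z (- A))"
    and min1: "\<And>l. l \<le> s1.levels A (restrict z (- A)) \<Longrightarrow>
      (\<Sum>i\<in>A. (Y $ i - (X *v s1.est A (restrict z (- A)) k1) $ i)\<^sup>2)
        \<le> (\<Sum>i\<in>A. (Y $ i - (X *v s1.est A (restrict z (- A)) l) $ i)\<^sup>2)"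
    and k2: "k2 \<le> s2.levels (- A) (restrict z (- (- A)))" "k0 \<le> s2.levels (- A) (restrict z (- (- A)))"
    and min2: "\<And>l. l \<le> s2.levels (- A) (restrict z (- (- A))) \<Longrightarrow>
      (\<Sum>i\<in>- A. (Y $ i - (X *v s2.est (- A) (restrict z (- (- A))) k2) $ i)\<^sup>2)
        \<le> (\<Sum>i\<in>- A. (Y $ i - (X *v s2.est (- A) (restrict z (- (- A))) l) $ i)\<^sup>2)"
    and mu: "\<And>i. \<mu> $ i = (if i \<in> A then (X *v s1.est A (restrict z (- A)) k1) $ i
      else (X *v s2.est (- A) (restrict z (- (- A))) k2) $ i)"
    and b: "is_arg_min (\<lambda>b. norm (Y - X *v b)) (\<lambda>b. l1_norm b \<le> l1_norm \<beta>s) b"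
    and c: "norm (\<mu> - X *v c) \<le> norm (\<mu> - X *v b)"
  shows "(norm (X *v \<beta>s - X *v c))\<^sup>2 \<le> total \<theta>1 \<theta>2 A z"
proof -
  let ?e1 = "s1.err A (restrict z (- A))" and ?e2 = "s2.err (- A) (restrict z (- (- A)))"
  define d where "d = norm (X *v \<beta>s - \<mu>)"
  define r where "r = norm (X *v \<beta>s - X *v b)"
  have f1: "(\<Sum>i\<in>A. (?e1 k1 i)\<^sup>2) \<le> s1.bound \<theta>1 A z"
    unfolding s1.bound_def
  proof (rule fold_error_le[where N = "s1.levels A", OF sigma assms(1) k1])
    have "z i - ?e1 l i = Y $ i - (X *v s1.est A (restrict z (- A)) l) $ i" for l i
      by (simp add: s1.err_def Y)
    then show "(\<Sum>i\<in>A. (z i - ?e1 k1 i)\<^sup>2) \<le> (\<Sum>i\<in>A. (z i - ?e1 l i)\<^sup>2)"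
      if "l \<le> s1.levels A (restrict z (- A))" for l
      by (simp only: min1[OF that])
  qed (rule s1.err_0)
  have f2: "(\<Sum>i\<in>- A. (?e2 k2 i)\<^sup>2) \<le> s2.bound \<theta>2 (- A) z"
    unfolding s2.bound_def
  proof (rule fold_error_le[where N = "s2.levels (- A)", OF sigma assms(2) k2])
    have "z i - ?e2 l i = Y $ i - (X *v s2.est (- A) (restrict z (- (- A))) l) $ i" for l i
      by (simp only: s2.err_def Y)
    then show "(\<Sum>i\<in>- A. (z i - ?e2 k2 i)\<^sup>2) \<le> (\<Sum>i\<in>- A. (z i - ?e2 l i)\<^sup>2)"
      if "l \<le> s2.levels (- A) (restrict z (- (- A)))" for l
      by (simp only: min2[OF that])
  qed (rule s2.err_0)
  have "d\<^sup>2 = (\<Sum>i\<in>A. (m i - \<mu> $ i)\<^sup>2) + (\<Sum>i\<in>- A. (m i - \<mu> $ i)\<^sup>2)"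
    unfolding d_def power2_norm_vec sum_UNIV_split[of _ A] by (simp add: m_def)
  also have "\<dots> = (\<Sum>i\<in>A. (?e1 k1 i)\<^sup>2) + (\<Sum>i\<in>- A. (?e2 k2 i)\<^sup>2)"
    by (intro arg_cong2[where f = "(+)"] sum.cong)
      (simp_all only: mu s1.err_def s2.err_def Compl_iff if_True if_False power2_commute)
  finally have d: "d\<^sup>2 \<le> s1.bound \<theta>1 A z + s2.bound \<theta>2 (- A) z"
    using f1 f2 by simp
  have le: "norm (Y - X *v b) \<le> norm (Y - X *v b')" if "l1_norm b' \<le> l1_norm \<beta>s" for b'
    using b that by (auto simp: is_arg_min_def not_less)
  \<comment> \<open>The final fit minimises a norm; squaring brings it into the form of the
    constrained least squares lemma.\<close>
  have "is_arg_min (\<lambda>b. \<Sum>i\<in>UNIV. (Y $ i - (X *v b) $ i)\<^sup>2) (\<lambda>b. l1_norm b \<le> l1_norm \<beta>s) b"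
    using b power_mono[OF le norm_ge_zero, of _ 2]
    by (auto simp: is_arg_min_def power2_norm_vec not_less)
  then have "(\<Sum>i\<in>UNIV. ((X *v b) $ i - (X *v \<beta>s) $ i)\<^sup>2) \<le> 2 * L * score UNIV z"
    unfolding score_def using Y delta
    by (intro constrained_ls_error_l1) (auto simp: m_def L_def)
  then have r: "r\<^sup>2 \<le> 2 * L * score UNIV z"
    by (simp add: r_def power2_norm_vec power2_commute)
  have "norm (X *v \<beta>s - X *v c) \<le> d + norm (\<mu> - X *v c)"
    using norm_triangle_ineq[of "X *v \<beta>s - \<mu>" "\<mu> - X *v c"] by (simp add: d_def)
  moreover have "norm (\<mu> - X *v b) \<le> d + r"
    using norm_triangle_ineq[of "\<mu> - X *v \<beta>s" "X *v \<beta>s - X *v b"]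
    by (simp add: d_def r_def norm_minus_commute)
  ultimately have "norm (X *v \<beta>s - X *v c) \<le> 2 * d + r"
    using c by simp
  then have "(norm (X *v \<beta>s - X *v c))\<^sup>2 \<le> (2 * d + r)\<^sup>2"
    by (intro power_mono) auto
  also have "\<dots> \<le> 24 / 5 * d\<^sup>2 + 6 * r\<^sup>2"
  proof -
    have "0 \<le> 4 / 5 * (d - 5 / 2 * r)\<^sup>2" by simp
    then show ?thesis by (simp add: power2_eq_square algebra_simps)
  qed
  also have "\<dots> \<le> total \<theta>1 \<theta>2 A z"
    unfolding total_def using d r by (intro add_mono mult_left_mono) (simp_all add: mult.assoc)
  finally show ?thesis .
qed

lemma measurable_total: "total \<theta>1 \<theta>2 A \<in> borel_measurable (PiM UNIV (\<lambda>_. borel))"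
proof -
  note s1.measurable_bound [measurable] s2.measurable_bound [measurable]
  show ?thesis
    unfolding total_def by measurable
qed

section \<open>Means over the split and the noise\<close>

definition score_rate :: real
  where "score_rate = \<sigma> * root 4 M * sqrt (2 * n * ln (2 * p))"

text \<open>Bounds the mean over the split of the sum of
  \<open>4 * \<sigma>\<^sup>2 + 2 * (m i)\<^sup>2\<close> over one fold, with the probability 1/2 of
  each index already included.\<close>

definition noise_energy :: real
  where "noise_energy = n * (2 * \<sigma>\<^sup>2 + L\<^sup>2 * sqrt M)"

definition log_levels1 :: ennreal
  where "log_levels1 = (\<integral>\<^sup>+A. \<integral>\<^sup>+z. ennreal (ln (real (s1.levels A (restrict z (- A))) + 1))
    \<partial>PiM UNIV (\<lambda>_. gauss \<sigma>) \<partial>random_subset)"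

definition log_levels2 :: ennreal
  where "log_levels2 = (\<integral>\<^sup>+A. \<integral>\<^sup>+z. ennreal (ln (real (s2.levels (- A) (restrict z (- (- A)))) + 1))
    \<partial>PiM UNIV (\<lambda>_. gauss \<sigma>) \<partial>random_subset)"

lemma score_rate_nonneg: "score_rate \<ge> 0"
  using sigma M_nonneg n_pos p_ge by (simp add: score_rate_def)

lemma expectation_energy:
  assumes "\<theta> > 0"
  shows "(\<integral>\<^sup>+A. ennreal (\<theta> * (\<Sum>i\<in>A. 4 * \<sigma>\<^sup>2 + 2 * (m i)\<^sup>2)) \<partial>random_subset) \<le> ennreal (\<theta> * noise_energy)"
proof -
  have "(\<integral>\<^sup>+A. ennreal (\<theta> * (\<Sum>i\<in>A. 4 * \<sigma>\<^sup>2 + 2 * (m i)\<^sup>2)) \<partial>random_subset)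
      = ennreal (\<theta> * ((\<Sum>i\<in>UNIV. 4 * \<sigma>\<^sup>2 + 2 * (m i)\<^sup>2) / 2))"
    using assms by (simp only: ennreal_mult'[OF less_imp_le[OF assms]] nn_integral_cmult)
      (simp add: nn_integral_cmult nn_integral_random_subset_sum)
  also have "\<dots> \<le> ennreal (\<theta> * noise_energy)"
    using assms signal_sq_le
    by (intro ennreal_leI mult_left_mono)
      (simp_all add: noise_energy_def sum.distrib n_def algebra_simps flip: sum_distrib_left)
  finally show ?thesis .
qed

text \<open>The folds have to be added first: \<open>swap_halves_le\<close> controls only the sum of
  the two out-of-sample errors. Each fold contributes \<open>2 * L\<close> times a score.\<close>

lemma expectation_fold_errors:
  "(\<integral>\<^sup>+z. ennreal (\<Sum>i\<in>A. (s1.err A (restrict z (- A)) k0 i)\<^sup>2) \<partial>PiM UNIV (\<lambda>_. gauss \<sigma>))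
    + (\<integral>\<^sup>+z. ennreal (\<Sum>i\<in>- A. (s2.err (- A) (restrict z (- (- A))) k0 i)\<^sup>2) \<partial>PiM UNIV (\<lambda>_. gauss \<sigma>))
    \<le> ennreal (4 * L * score_rate) + ennreal (6 * L\<^sup>2) * ennreal (imbalance A)"
proof -
  let ?U = "PiM UNIV (\<lambda>_. gauss \<sigma>) :: ('n \<Rightarrow> real) measure"
  interpret U: prob_space ?U
    by (intro prob_space_PiM prob_space_gauss sigma)
  have [measurable_cong]: "sets ?U = sets (PiM UNIV (\<lambda>_. borel))"
    by (intro sets_PiM_cong) auto
  have r [measurable]: "(\<lambda>z. restrict z B) \<in> measurable ?U (PiM B (\<lambda>_. borel :: real measure))" for B
    by (intro measurable_restrict) auto
  have [measurable]: "(\<lambda>z. s1.err A (restrict z (- A)) k0 i) \<in> borel_measurable ?U"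
      "(\<lambda>z. s2.err (- A) (restrict z (- (- A))) k0 i) \<in> borel_measurable ?U" for i
    by (rule measurable_compose[OF r s1.measurable_err] measurable_compose[OF r s2.measurable_err])+
  have pw: "(\<Sum>i\<in>A. (s1.err A (restrict z (- A)) k0 i)\<^sup>2) + (\<Sum>i\<in>- A. (s2.err (- A) (restrict z (- (- A))) k0 i)\<^sup>2)
      \<le> 2 * L * (score (- A) z + score (- (- A)) z) + 6 * L\<^sup>2 * imbalance A" for z
  proof -
    have L1: "l1_norm (s1.est A (restrict z (- A)) k0) \<le> L"
      "l1_norm (s2.est (- A) (restrict z (- (- A))) k0) \<le> L"
      using s1.l1_norm_est s2.l1_norm_est k0(2) order_trans by blast+
    show ?thesis
      using swap_halves_le[OF L1, of A] s1.err_in_sample[of A z] s2.err_in_sample[of "- A" z]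
      unfolding s1.err_def s2.err_def double_compl distrib_left by linarith
  qed
  have "(\<integral>\<^sup>+z. ennreal (\<Sum>i\<in>A. (s1.err A (restrict z (- A)) k0 i)\<^sup>2) \<partial>?U)
      + (\<integral>\<^sup>+z. ennreal (\<Sum>i\<in>- A. (s2.err (- A) (restrict z (- (- A))) k0 i)\<^sup>2) \<partial>?U)
      = (\<integral>\<^sup>+z. ennreal ((\<Sum>i\<in>A. (s1.err A (restrict z (- A)) k0 i)\<^sup>2)
        + (\<Sum>i\<in>- A. (s2.err (- A) (restrict z (- (- A))) k0 i)\<^sup>2)) \<partial>?U)"
    by (subst nn_integral_add[symmetric]) (simp_all add: sum_nonneg del: double_compl)
  also have "\<dots> \<le> (\<integral>\<^sup>+z. ennreal (2 * L * (score (- A) z + score (- (- A)) z) + 6 * L\<^sup>2 * imbalance A) \<partial>?U)"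
    by (intro nn_integral_mono ennreal_leI pw)
  also have "\<dots> = (\<integral>\<^sup>+z. ennreal (2 * L) * (ennreal (score (- A) z) + ennreal (score (- (- A)) z))
      + ennreal (6 * L\<^sup>2) * ennreal (imbalance A) \<partial>?U)"
    using L_pos score_nonneg imbalance_nonneg by (intro nn_integral_cong) (simp add: ennreal_mult)
  also have "\<dots> = ennreal (2 * L) * ((\<integral>\<^sup>+z. ennreal (score (- A) z) \<partial>?U) + (\<integral>\<^sup>+z. ennreal (score (- (- A)) z) \<partial>?U))
      + ennreal (6 * L\<^sup>2) * ennreal (imbalance A)"
    by (simp add: nn_integral_add nn_integral_cmult U.emeasure_space_1 del: double_compl)
  also have "\<dots> \<le> ennreal (2 * L) * (ennreal score_rate + ennreal score_rate)
      + ennreal (6 * L\<^sup>2) * ennreal (imbalance A)"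
    unfolding score_rate_def by (intro add_right_mono mult_left_mono add_mono expectation_score) auto
  also have "ennreal (2 * L) * (ennreal score_rate + ennreal score_rate) = ennreal (4 * L * score_rate)"
    using L_pos score_rate_nonneg by (simp flip: ennreal_plus ennreal_mult)
  finally show ?thesis .
qed

text \<open>Stated in \<open>ennreal\<close>, since \<open>log_levels1\<close> and
  \<open>log_levels2\<close> may be infinite. The weights are constants, fixed before split and
  noise, so they leave the integrals.\<close>

lemma expectation_total:
  assumes \<theta>: "\<theta>1 > 0" "\<theta>2 > 0"
  shows "(\<integral>\<^sup>+A. \<integral>\<^sup>+z. ennreal (total \<theta>1 \<theta>2 A z) \<partial>PiM UNIV (\<lambda>_. gauss \<sigma>) \<partial>random_subset)
    \<le> ennreal (24 / 5) * (ennreal (4 * L * score_rate) + ennreal (12 * L\<^sup>2 * sqrt M * sqrt (n * ln (2 * p)))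
        + (ennreal (\<theta>1 * noise_energy) + ennreal (16 / 3 * \<sigma>\<^sup>2 / \<theta>1) * log_levels1)
        + (ennreal (\<theta>2 * noise_energy) + ennreal (16 / 3 * \<sigma>\<^sup>2 / \<theta>2) * log_levels2))
      + ennreal (12 * L * score_rate)"
proof -
  let ?U = "PiM UNIV (\<lambda>_. gauss \<sigma>) :: ('n \<Rightarrow> real) measure"
  let ?q = "\<lambda>A. \<Sum>i\<in>A. 4 * \<sigma>\<^sup>2 + 2 * (m i)\<^sup>2"
  let ?c = "\<lambda>\<theta>. ennreal (16 / 3 * \<sigma>\<^sup>2 / \<theta>)"
  let ?l1 = "\<lambda>A. \<integral>\<^sup>+z. ennreal (ln (real (s1.levels A (restrict z (- A))) + 1)) \<partial>?U"
  let ?l2 = "\<lambda>A. \<integral>\<^sup>+z. ennreal (ln (real (s2.levels (- A) (restrict z (- (- A)))) + 1)) \<partial>?U"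
  have [measurable_cong]: "sets ?U = sets (PiM UNIV (\<lambda>_. borel))"
    by (intro sets_PiM_cong) auto
  note s1.measurable_bound [measurable] s2.measurable_bound [measurable]
  have inner: "(\<integral>\<^sup>+z. ennreal (total \<theta>1 \<theta>2 A z) \<partial>?U)
      \<le> ennreal (24 / 5) * (ennreal (4 * L * score_rate) + ennreal (6 * L\<^sup>2) * ennreal (imbalance A)
        + (ennreal (\<theta>1 * ?q A) + ?c \<theta>1 * ?l1 A) + (ennreal (\<theta>2 * ?q (- A)) + ?c \<theta>2 * ?l2 A))
      + ennreal (12 * L * score_rate)" for A
  proof -
    have "(\<integral>\<^sup>+z. ennreal (total \<theta>1 \<theta>2 A z) \<partial>?U)
        = (\<integral>\<^sup>+z. ennreal (24 / 5) * (ennreal (s1.bound \<theta>1 A z) + ennreal (s2.bound \<theta>2 (- A) z))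
          + ennreal (12 * L) * ennreal (score UNIV z) \<partial>?U)"
      unfolding total_def using L_pos score_nonneg s1.bound_nonneg[OF \<theta>(1)] s2.bound_nonneg[OF \<theta>(2)]
      by (intro nn_integral_cong) (simp flip: ennreal_plus ennreal_mult)
    also have "\<dots> = ennreal (24 / 5) * ((\<integral>\<^sup>+z. ennreal (s1.bound \<theta>1 A z) \<partial>?U) + (\<integral>\<^sup>+z. ennreal (s2.bound \<theta>2 (- A) z) \<partial>?U))
        + ennreal (12 * L) * (\<integral>\<^sup>+z. ennreal (score UNIV z) \<partial>?U)"
      by (simp add: nn_integral_add nn_integral_cmult)
    also have "\<dots> \<le> ennreal (24 / 5) * ((ennreal (4 * L * score_rate) + ennreal (6 * L\<^sup>2) * ennreal (imbalance A))
        + ((ennreal (\<theta>1 * ?q A) + ?c \<theta>1 * ?l1 A) + (ennreal (\<theta>2 * ?q (- A)) + ?c \<theta>2 * ?l2 A)))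
        + ennreal (12 * L) * ennreal score_rate"
    proof (rule add_mono[OF mult_left_mono mult_left_mono])
      let ?d1 = "\<integral>\<^sup>+z. ennreal (\<Sum>i\<in>A. (s1.err A (restrict z (- A)) k0 i)\<^sup>2) \<partial>?U"
      let ?d2 = "\<integral>\<^sup>+z. ennreal (\<Sum>i\<in>- A. (s2.err (- A) (restrict z (- (- A))) k0 i)\<^sup>2) \<partial>?U"
      have "(\<integral>\<^sup>+z. ennreal (s1.bound \<theta>1 A z) \<partial>?U) + (\<integral>\<^sup>+z. ennreal (s2.bound \<theta>2 (- A) z) \<partial>?U)
          \<le> (?d1 + ennreal (\<theta>1 * ?q A) + ?c \<theta>1 * ?l1 A) + (?d2 + ennreal (\<theta>2 * ?q (- A)) + ?c \<theta>2 * ?l2 A)"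
        by (intro add_mono s1.nn_integral_bound s2.nn_integral_bound \<theta>)
      also have "\<dots> = (?d1 + ?d2)
          + ((ennreal (\<theta>1 * ?q A) + ?c \<theta>1 * ?l1 A) + (ennreal (\<theta>2 * ?q (- A)) + ?c \<theta>2 * ?l2 A))"
        by (simp only: add_ac)
      also have "\<dots> \<le> (ennreal (4 * L * score_rate) + ennreal (6 * L\<^sup>2) * ennreal (imbalance A))
          + ((ennreal (\<theta>1 * ?q A) + ?c \<theta>1 * ?l1 A) + (ennreal (\<theta>2 * ?q (- A)) + ?c \<theta>2 * ?l2 A))"
        by (intro add_right_mono expectation_fold_errors)
      finally show "(\<integral>\<^sup>+z. ennreal (s1.bound \<theta>1 A z) \<partial>?U) + (\<integral>\<^sup>+z. ennreal (s2.bound \<theta>2 (- A) z) \<partial>?U) \<le> \<dots>" .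
      show "(\<integral>\<^sup>+z. ennreal (score UNIV z) \<partial>?U) \<le> ennreal score_rate"
        unfolding score_rate_def by (rule expectation_score)
    qed auto
    finally show ?thesis
      using L_pos score_rate_nonneg by (simp add: add.assoc flip: ennreal_mult)
  qed
  have "(\<integral>\<^sup>+A. \<integral>\<^sup>+z. ennreal (total \<theta>1 \<theta>2 A z) \<partial>?U \<partial>random_subset)
      \<le> (\<integral>\<^sup>+A. ennreal (24 / 5) * (ennreal (4 * L * score_rate) + ennreal (6 * L\<^sup>2) * ennreal (imbalance A)
        + (ennreal (\<theta>1 * ?q A) + ?c \<theta>1 * ?l1 A) + (ennreal (\<theta>2 * ?q (- A)) + ?c \<theta>2 * ?l2 A))
        + ennreal (12 * L * score_rate) \<partial>random_subset)"
    by (intro nn_integral_mono inner)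
  also have "\<dots> = ennreal (24 / 5) * (ennreal (4 * L * score_rate)
        + ennreal (6 * L\<^sup>2) * (\<integral>\<^sup>+A. ennreal (imbalance A) \<partial>random_subset)
        + ((\<integral>\<^sup>+A. ennreal (\<theta>1 * ?q A) \<partial>random_subset) + ?c \<theta>1 * log_levels1)
        + ((\<integral>\<^sup>+A. ennreal (\<theta>2 * ?q (- A)) \<partial>random_subset) + ?c \<theta>2 * log_levels2))
      + ennreal (12 * L * score_rate)"
    unfolding log_levels1_def log_levels2_def
    by (simp add: nn_integral_add nn_integral_cmult measure_pmf.emeasure_space_1 del: double_compl)
  also have "\<dots> \<le> ennreal (24 / 5) * (ennreal (4 * L * score_rate)
        + ennreal (6 * L\<^sup>2) * ennreal (2 * sqrt M * sqrt (n * ln (2 * p)))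
        + (ennreal (\<theta>1 * noise_energy) + ?c \<theta>1 * log_levels1)
        + (ennreal (\<theta>2 * noise_energy) + ?c \<theta>2 * log_levels2))
      + ennreal (12 * L * score_rate)"
    using expectation_energy[OF \<theta>(1)] expectation_energy[OF \<theta>(2)] expectation_imbalance
    unfolding nn_integral_random_subset_Compl[of "\<lambda>A. ennreal (\<theta>2 * ?q A)"]
    by (intro add_mono mult_left_mono order_refl) auto
  also have "ennreal (6 * L\<^sup>2) * ennreal (2 * sqrt M * sqrt (n * ln (2 * p)))
      = ennreal (12 * L\<^sup>2 * sqrt M * sqrt (n * ln (2 * p)))"
    by (subst ennreal_mult'[symmetric]) (simp_all add: mult_ac)
  finally show ?thesis .
qed

section \<open>Numerical constants and the choice of weights\<close>

text \<open>The origin of 24/5. If the squared error of \<open>\<mu>\<close> enters with factor w,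
  squaring compares 4 * w^2 * 16/3 with 2 * 16^2 = 512, so w^2 must not exceed 24, and 24/5 lies
  just below the root of 24.\<close>

lemma optimized_noise_le:
  assumes "l \<ge> 0"
  shows "2 * sqrt ((24 / 5 * noise_energy) * (24 / 5 * (16 / 3 * \<sigma>\<^sup>2 * l)))
    \<le> 16 * sqrt (4 * \<sigma> ^ 4 + 2 * L\<^sup>2 * sqrt M * \<sigma>\<^sup>2) * (sqrt n * sqrt l)"
proof -
  let ?q = "2 * \<sigma>\<^sup>2 + L\<^sup>2 * sqrt M"
  have "2 * sqrt ((24 / 5 * noise_energy) * (24 / 5 * (16 / 3 * \<sigma>\<^sup>2 * l)))
      = sqrt (2\<^sup>2 * ((24 / 5 * noise_energy) * (24 / 5 * (16 / 3 * \<sigma>\<^sup>2 * l))))"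
    by (simp only: real_sqrt_mult[of "2\<^sup>2"] real_sqrt_abs)
  also have "2\<^sup>2 * ((24 / 5 * noise_energy) * (24 / 5 * (16 / 3 * \<sigma>\<^sup>2 * l)))
      = 12288 / 25 * (?q * \<sigma>\<^sup>2 * n * l)"
    by (simp add: noise_energy_def)
  also have "sqrt \<dots> \<le> sqrt (512 * (?q * \<sigma>\<^sup>2 * n * l))"
    using assms n_pos M_nonneg by (intro real_sqrt_le_mono mult_right_mono) auto
  also have "512 * (?q * \<sigma>\<^sup>2 * n * l) = 16\<^sup>2 * ((2 * ?q * \<sigma>\<^sup>2) * (n * l))"
    by simp
  also have "sqrt (16\<^sup>2 * ((2 * ?q * \<sigma>\<^sup>2) * (n * l))) = 16 * (sqrt (2 * ?q * \<sigma>\<^sup>2) * (sqrt n * sqrt l))"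
    by (simp only: real_sqrt_mult[of "16\<^sup>2"] real_sqrt_mult[of "2 * ?q * \<sigma>\<^sup>2"] real_sqrt_mult[of n] real_sqrt_abs)
  also have "2 * ?q * \<sigma>\<^sup>2 = 4 * \<sigma> ^ 4 + 2 * L\<^sup>2 * sqrt M * \<sigma>\<^sup>2"
    by (simp add: algebra_simps flip: power_add)
  finally show ?thesis
    by (simp add: mult.assoc)
qed

lemma score_terms_le:
  "24 / 5 * (4 * L * score_rate + 12 * L\<^sup>2 * sqrt M * sqrt (n * ln (2 * p))) + 12 * L * score_rate
    \<le> (96 * L\<^sup>2 * sqrt M + 57 * L * root 4 M * \<sigma>) * sqrt (n * ln (2 * p))"
proof -
  let ?t = "sqrt (n * ln (2 * p))"
  have t: "?t \<ge> 0" using n_pos p_ge by simp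
  have rate: "score_rate = root 4 M * \<sigma> * (sqrt 2 * ?t)"
    by (simp add: score_rate_def real_sqrt_mult)
  have "sqrt 2 \<le> (3 / 2 :: real)"
    by (rule real_le_lsqrt) (auto simp: power2_eq_square)
  \<comment> \<open>Here 156/5 = 24/5 * 4 + 12 collects the scores of the two folds and of the full
    fit; 288/5 = 24/5 * 12 below stems from swapping the halves.\<close>
  then have "156 / 5 * sqrt 2 \<le> (57 :: real)"
    by simp
  then have "156 / 5 * sqrt 2 * (L * root 4 M * \<sigma> * ?t) \<le> 57 * (L * root 4 M * \<sigma> * ?t)"
    using L_pos M_nonneg sigma t by (intro mult_right_mono) auto
  moreover have "288 / 5 * (L\<^sup>2 * sqrt M * ?t) \<le> 96 * (L\<^sup>2 * sqrt M * ?t)"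
    using M_nonneg t by (intro mult_right_mono) auto
  ultimately show ?thesis
    by (simp add: rate algebra_simps)
qed

text \<open>The two weights occur in separate summands, so they are optimised one after the other,
  the terms of \<open>\<theta>1\<close> counting as constants while \<open>\<theta>2\<close>
  varies.\<close>

lemma real_bound_from_weights:
  assumes "l1 \<ge> 0" and "l2 \<ge> 0"
    and le: "\<And>\<theta>1 \<theta>2. \<theta>1 > 0 \<Longrightarrow> \<theta>2 > 0 \<Longrightarrow> n * e \<le>
      24 / 5 * (4 * L * score_rate + 12 * L\<^sup>2 * sqrt M * sqrt (n * ln (2 * p))
        + (\<theta>1 * noise_energy + 16 / 3 * \<sigma>\<^sup>2 / \<theta>1 * l1) + (\<theta>2 * noise_energy + 16 / 3 * \<sigma>\<^sup>2 / \<theta>2 * l2))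
      + 12 * L * score_rate"
  shows "e \<le> 16 * sqrt (4 * \<sigma> ^ 4 + 2 * L\<^sup>2 * sqrt M * \<sigma>\<^sup>2) * (sqrt l1 + sqrt l2) / sqrt n
    + (96 * L\<^sup>2 * sqrt M + 57 * L * root 4 M * \<sigma>) * sqrt (ln (2 * p) / n)"
proof -
  let ?C1 = "16 * sqrt (4 * \<sigma> ^ 4 + 2 * L\<^sup>2 * sqrt M * \<sigma>\<^sup>2)"
  let ?C2 = "96 * L\<^sup>2 * sqrt M + 57 * L * root 4 M * \<sigma>"
  let ?K = "24 / 5 * (4 * L * score_rate + 12 * L\<^sup>2 * sqrt M * sqrt (n * ln (2 * p))) + 12 * L * score_rate"
  let ?a = "24 / 5 * noise_energy" and ?b = "\<lambda>l. 24 / 5 * (16 / 3 * \<sigma>\<^sup>2 * l)"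
  have a: "?a \<ge> 0"
    using n_pos M_nonneg by (simp add: noise_energy_def)
  have step: "n * e \<le> ?K + \<theta>1 * ?a + ?b l1 / \<theta>1 + \<theta>2 * ?a + ?b l2 / \<theta>2"
    if "\<theta>1 > 0" "\<theta>2 > 0" for \<theta>1 \<theta>2
    using le[OF that] by (simp add: algebra_simps)
  have "n * e \<le> (?K + \<theta>1 * ?a + ?b l1 / \<theta>1) + 2 * sqrt (?a * ?b l2)" if "\<theta>1 > 0" for \<theta>1
    using step[OF that] a assms(2) by (intro le_two_sqrt_from_weights) auto
  then have "n * e \<le> (?K + 2 * sqrt (?a * ?b l2)) + \<theta>1 * ?a + ?b l1 / \<theta>1" if "\<theta>1 > 0" for \<theta>1
    using that by (simp add: algebra_simps)
  then have "n * e \<le> (?K + 2 * sqrt (?a * ?b l2)) + 2 * sqrt (?a * ?b l1)"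
    using a assms(1) by (intro le_two_sqrt_from_weights) auto
  also have "\<dots> \<le> ?C2 * sqrt (n * ln (2 * p)) + ?C1 * (sqrt n * sqrt l2) + ?C1 * (sqrt n * sqrt l1)"
    using score_terms_le optimized_noise_le[OF assms(1)] optimized_noise_le[OF assms(2)] by linarith
  also have "\<dots> = n * (?C1 * (sqrt l1 + sqrt l2) / sqrt n + ?C2 * sqrt (ln (2 * p) / n))"
  proof -
    have root: "sqrt n * v = n * (v / sqrt n)" for v
    proof -
      have "sqrt n * v = n / sqrt n * v"
        using n_pos by (simp add: real_div_sqrt)
      then show ?thesis by simp
    qed
    have "?C1 * (sqrt n * sqrt l2) + ?C1 * (sqrt n * sqrt l1) = sqrt n * (?C1 * (sqrt l1 + sqrt l2))"
      by (simp add: algebra_simps)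
    moreover have "sqrt (n * ln (2 * p)) = n * sqrt (ln (2 * p) / n)"
      using root[of "sqrt (ln (2 * p))"] by (simp add: real_sqrt_mult real_sqrt_divide)
    ultimately show ?thesis
      unfolding root by (simp add: algebra_simps)
  qed
  finally show ?thesis
    using n_pos by simp
qed

end

section \<open>The cross-validated Lasso\<close>

theorem theorem2p1:
  fixes P :: "'w measure"
    and X :: "real ^ 'p ^ 'n"
    and \<beta>s :: "real ^ 'p"
    and \<sigma> \<delta> :: real
    and \<epsilon> Y :: "'w \<Rightarrow> real ^ 'n"
    and I :: "'w \<Rightarrow> 'n set"
    and g1 g2 :: "'n set \<Rightarrow> ('n \<Rightarrow> real) \<Rightarrow> real \<Rightarrow> real ^ 'p"
    and \<beta>1 \<beta>2 \<beta>h :: "real \<Rightarrow> 'w \<Rightarrow> real ^ 'p"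
    and f1 f2 :: "'n set \<Rightarrow> ('n \<Rightarrow> real) \<Rightarrow> nat"
    and N1 N2 :: "'w \<Rightarrow> nat"
    and K1 K2 Kh :: "'w \<Rightarrow> real"
    and \<mu> :: "'w \<Rightarrow> real ^ 'n"
    and \<beta>CV :: "'w \<Rightarrow> real ^ 'p"
  assumes prob: "prob_space P"
    and sigma: "\<sigma> > 0"
    and delta: "\<delta> > 0"
    and eps_indep: "prob_space.indep_vars P (\<lambda>_. borel) (\<lambda>i \<omega>. \<epsilon> \<omega> $ i) UNIV"
    and eps_normal: "\<And>i. distributed P lborel (\<lambda>\<omega>. \<epsilon> \<omega> $ i) (normal_density 0 \<sigma>)"
    and model: "\<And>\<omega>. \<omega> \<in> space P \<Longrightarrow> Y \<omega> = X *v \<beta>s + \<epsilon> \<omega>"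
    and I_indep: "prob_space.indep_events P (\<lambda>i. {\<omega> \<in> space P. i \<in> I \<omega>}) UNIV"
    and I_half: "\<And>i. measure P {\<omega> \<in> space P. i \<in> I \<omega>} = 1 / 2"
    and I_eps: "indep_random_variables P (count_space UNIV) I borel \<epsilon>"
    and rule1: "lasso_rule X g1"
    and rule2: "lasso_rule X g2"
    and beta1: "\<And>K \<omega>. K \<ge> 0 \<Longrightarrow> \<omega> \<in> space P \<Longrightarrow>
      \<beta>1 K \<omega> = g1 (I \<omega>) (data_on (I \<omega>) (Y \<omega>)) K"
    and beta2: "\<And>K \<omega>. K \<ge> 0 \<Longrightarrow> \<omega> \<in> space P \<Longrightarrow>
      \<beta>2 K \<omega> = g2 (- I \<omega>) (data_on (- I \<omega>) (Y \<omega>)) K"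
    and f1: "\<And>A. f1 A \<in> measurable (PiM A (\<lambda>_. borel)) (count_space UNIV)"
    and f2: "\<And>A. f2 A \<in> measurable (PiM A (\<lambda>_. borel)) (count_space UNIV)"
    and N1: "\<And>\<omega>. \<omega> \<in> space P \<Longrightarrow> N1 \<omega> = f1 (- I \<omega>) (data_on (- I \<omega>) (Y \<omega>))"
    and N2: "\<And>\<omega>. \<omega> \<in> space P \<Longrightarrow> N2 \<omega> = f2 (I \<omega>) (data_on (I \<omega>) (Y \<omega>))"
    and K1_rv: "K1 \<in> borel_measurable P"
    and K1_min: "\<And>\<omega>. \<omega> \<in> space P \<Longrightarrow>
      is_arg_min (\<lambda>K. \<Sum>i\<in>I \<omega>. (Y \<omega> $ i - (X *v \<beta>2 K \<omega>) $ i)\<^sup>2)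
        (\<lambda>K. K \<in> {real k * \<delta> | k. k \<le> N1 \<omega>}) (K1 \<omega>)"
    and K2_rv: "K2 \<in> borel_measurable P"
    and K2_min: "\<And>\<omega>. \<omega> \<in> space P \<Longrightarrow>
      is_arg_min (\<lambda>K. \<Sum>i\<in>- I \<omega>. (Y \<omega> $ i - (X *v \<beta>1 K \<omega>) $ i)\<^sup>2)
        (\<lambda>K. K \<in> {real k * \<delta> | k. k \<le> N2 \<omega>}) (K2 \<omega>)"
    and mu: "\<And>\<omega> i. \<omega> \<in> space P \<Longrightarrow>
      \<mu> \<omega> $ i = (if i \<in> I \<omega> then (X *v \<beta>2 (K1 \<omega>) \<omega>) $ i else (X *v \<beta>1 (K2 \<omega>) \<omega>) $ i)"
    and betah: "\<And>K \<omega>. K \<ge> 0 \<Longrightarrow> \<omega> \<in> space P \<Longrightarrow>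
      is_arg_min (\<lambda>b. norm (Y \<omega> - X *v b)) (\<lambda>b. l1_norm b \<le> K) (\<beta>h K \<omega>)"
    and Kh_rv: "Kh \<in> borel_measurable P"
    and Kh_min: "\<And>\<omega>. \<omega> \<in> space P \<Longrightarrow>
      is_arg_min (\<lambda>K. norm (\<mu> \<omega> - X *v \<beta>h K \<omega>)) (\<lambda>K. K \<ge> 0) (Kh \<omega>)"
    and betaCV: "\<And>\<omega>. \<omega> \<in> space P \<Longrightarrow> \<beta>CV \<omega> = \<beta>h (Kh \<omega>) \<omega>"
  shows "let n = real CARD('n);
             p = real CARD('p);
             L = l1_norm \<beta>s + \<delta>;
             M = Max (range (\<lambda>j. (1 / n) * (\<Sum>i\<in>UNIV. (X $ i $ j) ^ 4)));
             l1 = \<integral>\<^sup>+\<omega>. ennreal (ln (real (N1 \<omega>) + 1)) \<partial>P;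
             l2 = \<integral>\<^sup>+\<omega>. ennreal (ln (real (N2 \<omega>) + 1)) \<partial>P;
             C1 = 16 * sqrt (4 * \<sigma> ^ 4 + 2 * L\<^sup>2 * sqrt M * \<sigma>\<^sup>2);
             C2 = 96 * L\<^sup>2 * sqrt M + 57 * L * root 4 M * \<sigma>;
             E = 16 * sqrt ((n + 5) * \<sigma> ^ 4 / n + (n + 1) * \<sigma>\<^sup>2 / n * L\<^sup>2 * sqrt M)
                  * ((1 + 2 powr (- 1 / 2)) / 2) powr (n / 2)
         in (\<integral>\<^sup>+\<omega>. ennreal ((norm (X *v \<beta>s - X *v \<beta>CV \<omega>))\<^sup>2 / n)
                * indicator {\<omega>. real (N1 \<omega>) * \<delta> \<ge> l1_norm \<beta>s \<and> real (N2 \<omega>) * \<delta> \<ge> l1_norm \<beta>s} \<omega> \<partial>P)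
            \<le> ennreal C1 * (ennreal_sqrt l1 + ennreal_sqrt l2) / ennreal (sqrt n)
               + ennreal (C2 * sqrt (ln (2 * p) / n)) + ennreal E"
proof -
  interpret prob_space P by (rule prob)
  interpret cv_lasso X \<beta>s \<sigma> \<delta> g1 g2 f1 f2
    using sigma delta rule1 rule2 f1 f2 by unfold_locales
  define z where "z \<omega> i = \<epsilon> \<omega> $ i" for \<omega> i
  note split = nn_integral_split_design[OF sigma eps_indep eps_normal I_indep I_half I_eps, folded z_def]
  have Y: "Y \<omega> $ i = m i + z \<omega> i" if "\<omega> \<in> space P" for \<omega> i
    using model[OF that] by (simp add: m_def z_def)
  \<comment> \<open>\<open>obs\<close> depends on neither the estimation rule nor the level rule, so
    this equation serves both folds.\<close>
  have data: "data_on B (Y \<omega>) = s1.obs B (restrict (z \<omega>) B)" if "\<omega> \<in> space P" for B \<omega>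
    unfolding s1.obs_restrict by (simp add: data_on_def s1.obs_def Y[OF that])
  have N1': "N1 \<omega> = s1.levels (I \<omega>) (restrict (z \<omega>) (- I \<omega>))" if "\<omega> \<in> space P" for \<omega>
    unfolding s1.levels_def data[OF that, symmetric] by (rule N1[OF that])
  have N2': "N2 \<omega> = s2.levels (- I \<omega>) (restrict (z \<omega>) (- (- I \<omega>)))" if "\<omega> \<in> space P" for \<omega>
    unfolding s2.levels_def data[OF that, symmetric] double_compl by (rule N2[OF that])
  have est1: "\<beta>2 (real k * \<delta>) \<omega> = s1.est (I \<omega>) (restrict (z \<omega>) (- I \<omega>)) k" if "\<omega> \<in> space P" for k \<omega>
    unfolding s1.est_def data[OF that, symmetric] using that delta by (intro beta2) auto
  have est2: "\<beta>1 (real k * \<delta>) \<omega> = s2.est (- I \<omega>) (restrict (z \<omega>) (- (- I \<omega>))) k" if "\<omega> \<in> space P" for k \<omega>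
    unfolding s2.est_def data[OF that, symmetric] double_compl using that delta by (intro beta1) auto
  define ev where "ev = {\<omega>. real (N1 \<omega>) * \<delta> \<ge> l1_norm \<beta>s \<and> real (N2 \<omega>) * \<delta> \<ge> l1_norm \<beta>s}"
  define loss where "loss = (\<integral>\<^sup>+\<omega>. ennreal ((norm (X *v \<beta>s - X *v \<beta>CV \<omega>))\<^sup>2 / n) * indicator ev \<omega> \<partial>P)"
  have pw: "(norm (X *v \<beta>s - X *v \<beta>CV \<omega>))\<^sup>2 \<le> total \<theta>1 \<theta>2 (I \<omega>) (z \<omega>)"
    if \<theta>: "\<theta>1 > 0" "\<theta>2 > 0" and \<omega>: "\<omega> \<in> space P" and "\<omega> \<in> ev" for \<theta>1 \<theta>2 \<omega>
  proof -
    from K1_min[OF \<omega>] obtain k1 where k1: "K1 \<omega> = real k1 * \<delta>" "k1 \<le> N1 \<omega>"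
      by (auto simp: is_arg_min_def)
    from K2_min[OF \<omega>] obtain k2 where k2: "K2 \<omega> = real k2 * \<delta>" "k2 \<le> N2 \<omega>"
      by (auto simp: is_arg_min_def)
    have N: "k0 \<le> N1 \<omega>" "k0 \<le> N2 \<omega>"
      using \<open>\<omega> \<in> ev\<close> by (auto simp: ev_def intro: k0_le)
    have min1: "(\<Sum>i\<in>I \<omega>. (Y \<omega> $ i - (X *v \<beta>2 (real k1 * \<delta>) \<omega>) $ i)\<^sup>2)
        \<le> (\<Sum>i\<in>I \<omega>. (Y \<omega> $ i - (X *v \<beta>2 (real l * \<delta>) \<omega>) $ i)\<^sup>2)" if "l \<le> N1 \<omega>" for l
      by (rule conjunct2[OF K1_min[OF \<omega>, unfolded is_arg_min_linorder k1(1)], rule_format])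
        (use that in auto)
    have min2: "(\<Sum>i\<in>- I \<omega>. (Y \<omega> $ i - (X *v \<beta>1 (real k2 * \<delta>) \<omega>) $ i)\<^sup>2)
        \<le> (\<Sum>i\<in>- I \<omega>. (Y \<omega> $ i - (X *v \<beta>1 (real l * \<delta>) \<omega>) $ i)\<^sup>2)" if "l \<le> N2 \<omega>" for l
      by (rule conjunct2[OF K2_min[OF \<omega>, unfolded is_arg_min_linorder k2(1)], rule_format])
        (use that in auto)
    \<comment> \<open>\<open>Kh\<close> ranges over all nonnegative reals, so the level
      \<open>l1_norm \<beta>s\<close> itself competes, without rounding to the grid.\<close>
    have CV: "norm (\<mu> \<omega> - X *v \<beta>CV \<omega>) \<le> norm (\<mu> \<omega> - X *v \<beta>h (l1_norm \<beta>s) \<omega>)"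
      using Kh_min[OF \<omega>] l1_norm_nonneg[of \<beta>s] by (auto simp: is_arg_min_def betaCV[OF \<omega>] not_less)
    show ?thesis
    proof (rule prediction_error_le[OF \<theta> Y[OF \<omega>], of k1 "I \<omega>" k2 "\<mu> \<omega>" "\<beta>h (l1_norm \<beta>s) \<omega>"])
      show "\<mu> \<omega> $ i = (if i \<in> I \<omega> then (X *v s1.est (I \<omega>) (restrict (z \<omega>) (- I \<omega>)) k1) $ i
          else (X *v s2.est (- I \<omega>) (restrict (z \<omega>) (- (- I \<omega>))) k2) $ i)" for i
        by (simp only: mu[OF \<omega>] k1(1) k2(1) est1[OF \<omega>] est2[OF \<omega>])
    qed (use k1(2) k2(2) N min1 min2 CV betah[OF l1_norm_nonneg \<omega>] in
      \<open>simp_all only: N1'[OF \<omega>] N2'[OF \<omega>] est1[OF \<omega>] est2[OF \<omega>]\<close>)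
  qed
  have logs: "(\<integral>\<^sup>+\<omega>. ennreal (ln (real (N1 \<omega>) + 1)) \<partial>P) = log_levels1"
    "(\<integral>\<^sup>+\<omega>. ennreal (ln (real (N2 \<omega>) + 1)) \<partial>P) = log_levels2"
  proof -
    have "(\<lambda>z. ennreal (ln (real (s1.levels A (restrict z (- A))) + 1))) \<in> borel_measurable (PiM UNIV (\<lambda>_. borel))"
      "(\<lambda>z. ennreal (ln (real (s2.levels (- A) (restrict z (- (- A)))) + 1))) \<in> borel_measurable (PiM UNIV (\<lambda>_. borel))" for A
      using s1.measurable_levels_restrict[of A] s2.measurable_levels_restrict[of "- A"] by measurable
    then show "(\<integral>\<^sup>+\<omega>. ennreal (ln (real (N1 \<omega>) + 1)) \<partial>P) = log_levels1"
      "(\<integral>\<^sup>+\<omega>. ennreal (ln (real (N2 \<omega>) + 1)) \<partial>P) = log_levels2"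
      unfolding log_levels1_def log_levels2_def
      by (subst split[symmetric]; auto simp: N1' N2' simp del: double_compl intro!: nn_integral_cong)+
  qed
  have loss_le: "loss \<le> ennreal (1 / n) *
      (ennreal (24 / 5) * (ennreal (4 * L * score_rate) + ennreal (12 * L\<^sup>2 * sqrt M * sqrt (n * ln (2 * p)))
        + (ennreal (\<theta>1 * noise_energy) + ennreal (16 / 3 * \<sigma>\<^sup>2 / \<theta>1) * log_levels1)
        + (ennreal (\<theta>2 * noise_energy) + ennreal (16 / 3 * \<sigma>\<^sup>2 / \<theta>2) * log_levels2))
      + ennreal (12 * L * score_rate))" if \<theta>: "\<theta>1 > 0" "\<theta>2 > 0" for \<theta>1 \<theta>2
  proof -
    note measurable_total [measurable]
    have [measurable_cong]: "sets (PiM UNIV (\<lambda>_ :: 'n. gauss \<sigma>)) = sets (PiM UNIV (\<lambda>_. borel))"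
      by (intro sets_PiM_cong) auto
    have "loss \<le> (\<integral>\<^sup>+\<omega>. ennreal (1 / n) * ennreal (total \<theta>1 \<theta>2 (I \<omega>) (z \<omega>)) \<partial>P)"
      unfolding loss_def
    proof (intro nn_integral_mono)
      fix \<omega> assume "\<omega> \<in> space P"
      then have "(norm (X *v \<beta>s - X *v \<beta>CV \<omega>))\<^sup>2 / n \<le> 1 / n * total \<theta>1 \<theta>2 (I \<omega>) (z \<omega>)" if "\<omega> \<in> ev"
        using pw[OF \<theta> _ that] n_pos by (simp add: divide_right_mono)
      then show "ennreal ((norm (X *v \<beta>s - X *v \<beta>CV \<omega>))\<^sup>2 / n) * indicator ev \<omega>
          \<le> ennreal (1 / n) * ennreal (total \<theta>1 \<theta>2 (I \<omega>) (z \<omega>))"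
        using n_pos by (auto simp: indicator_def ennreal_leI simp flip: ennreal_mult')
    qed
    \<comment> \<open>The pointwise bound depends on the sample point only through the split and the
      noise, so their joint law can be inserted.\<close>
    also have "\<dots> = (\<integral>\<^sup>+A. \<integral>\<^sup>+z. ennreal (1 / n) * ennreal (total \<theta>1 \<theta>2 A z) \<partial>PiM UNIV (\<lambda>_. gauss \<sigma>) \<partial>random_subset)"
      by (rule split) measurable
    also have "\<dots> = ennreal (1 / n) * (\<integral>\<^sup>+A. \<integral>\<^sup>+z. ennreal (total \<theta>1 \<theta>2 A z) \<partial>PiM UNIV (\<lambda>_. gauss \<sigma>) \<partial>random_subset)"
      by (simp add: nn_integral_cmult)
    also have "\<dots> \<le> ennreal (1 / n) *
      (ennreal (24 / 5) * (ennreal (4 * L * score_rate) + ennreal (12 * L\<^sup>2 * sqrt M * sqrt (n * ln (2 * p)))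
        + (ennreal (\<theta>1 * noise_energy) + ennreal (16 / 3 * \<sigma>\<^sup>2 / \<theta>1) * log_levels1)
        + (ennreal (\<theta>2 * noise_energy) + ennreal (16 / 3 * \<sigma>\<^sup>2 / \<theta>2) * log_levels2))
      + ennreal (12 * L * score_rate))"
      by (intro mult_left_mono expectation_total \<theta>) simp
    finally show ?thesis .
  qed
  define C1 where "C1 = 16 * sqrt (4 * \<sigma> ^ 4 + 2 * L\<^sup>2 * sqrt M * \<sigma>\<^sup>2)"
  define C2 where "C2 = 96 * L\<^sup>2 * sqrt M + 57 * L * root 4 M * \<sigma>"
  have C1: "C1 > 0"
    using sigma M_nonneg by (simp add: C1_def add_pos_nonneg)
  have C2: "C2 \<ge> 0"
    using sigma M_nonneg L_pos by (simp add: C2_def)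
  have main: "loss \<le> ennreal C1 * (ennreal_sqrt log_levels1 + ennreal_sqrt log_levels2) / ennreal (sqrt n)
      + ennreal (C2 * sqrt (ln (2 * p) / n))"
  proof (cases "log_levels1 = \<infinity> \<or> log_levels2 = \<infinity>")
    \<comment> \<open>An infinite mean makes the right-hand side infinite, because \<open>C1\<close>
      is strictly positive.\<close>
    case True
    then have top: "ennreal_sqrt log_levels1 + ennreal_sqrt log_levels2 = \<infinity>"
      by (auto simp: ennreal_sqrt_def)
    have "ennreal C1 * (ennreal_sqrt log_levels1 + ennreal_sqrt log_levels2) / ennreal (sqrt n) = \<infinity>"
      unfolding top using C1 by (simp add: ennreal_mult_top ennreal_top_divide)
    then show ?thesis by simp
  next
    case False
    then obtain l1 l2 where l: "l1 \<ge> 0" "log_levels1 = ennreal l1" "l2 \<ge> 0" "log_levels2 = ennreal l2"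
      by (cases log_levels1; cases log_levels2) auto
    define R where "R \<theta>1 \<theta>2 = 24 / 5 * (4 * L * score_rate + 12 * L\<^sup>2 * sqrt M * sqrt (n * ln (2 * p))
        + (\<theta>1 * noise_energy + 16 / 3 * \<sigma>\<^sup>2 / \<theta>1 * l1) + (\<theta>2 * noise_energy + 16 / 3 * \<sigma>\<^sup>2 / \<theta>2 * l2))
      + 12 * L * score_rate" for \<theta>1 \<theta>2
    have R: "loss \<le> ennreal (1 / n * R \<theta>1 \<theta>2)" "R \<theta>1 \<theta>2 \<ge> 0" if \<theta>: "\<theta>1 > 0" "\<theta>2 > 0" for \<theta>1 \<theta>2
    proof -
      have conv: "ennreal (1 / n) * (ennreal (24 / 5) * (ennreal a + ennreal b
            + (ennreal c1 + ennreal d1 * ennreal l1) + (ennreal c2 + ennreal d2 * ennreal l2)) + ennreal w)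
          = ennreal (1 / n * (24 / 5 * (a + b + (c1 + d1 * l1) + (c2 + d2 * l2)) + w))"
        if "a \<ge> 0" "b \<ge> 0" "c1 \<ge> 0" "d1 \<ge> 0" "c2 \<ge> 0" "d2 \<ge> 0" "w \<ge> 0" for a b c1 d1 c2 d2 w
        using that l n_pos by (simp only: ennreal_plus[symmetric] ennreal_mult[symmetric]
          add_nonneg_nonneg mult_nonneg_nonneg divide_nonneg_nonneg zero_le_numeral zero_le_one less_imp_le)
      have nonneg: "4 * L * score_rate \<ge> 0" "12 * L\<^sup>2 * sqrt M * sqrt (n * ln (2 * p)) \<ge> 0" "12 * L * score_rate \<ge> 0"
        "\<theta> * noise_energy \<ge> 0" "16 / 3 * \<sigma>\<^sup>2 / \<theta> \<ge> 0" if "\<theta> > 0" for \<theta>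
        using L_pos score_rate_nonneg M_nonneg n_pos p_ge that by (simp_all add: noise_energy_def)
      show "R \<theta>1 \<theta>2 \<ge> 0"
        unfolding R_def using L_pos score_rate_nonneg M_nonneg n_pos p_ge \<theta> l
        by (intro add_nonneg_nonneg mult_nonneg_nonneg) (auto simp: noise_energy_def)
      show "loss \<le> ennreal (1 / n * R \<theta>1 \<theta>2)"
        using loss_le[OF \<theta>] unfolding l(2,4) R_def
        by (subst (asm) conv) (use nonneg[OF \<theta>(1)] nonneg[OF \<theta>(2)] l in auto)
    qed
    \<comment> \<open>Any fixed pair of weights shows that the loss is finite, so the optimisation
      can be carried out over the reals.\<close>
    have "loss < \<infinity>"
      using R(1)[of 1 1] by (auto simp: le_less_trans)
    then obtain e where e: "e \<ge> 0" "loss = ennreal e"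
      by (cases loss) auto
    have "n * e \<le> R \<theta>1 \<theta>2" if \<theta>: "\<theta>1 > 0" "\<theta>2 > 0" for \<theta>1 \<theta>2
    proof -
      have "e \<le> 1 / n * R \<theta>1 \<theta>2"
        using R[OF \<theta>] n_pos unfolding e by (subst (asm) ennreal_le_iff) auto
      then show ?thesis
        using n_pos by (simp add: field_simps)
    qed
    then have "e \<le> C1 * (sqrt l1 + sqrt l2) / sqrt n + C2 * sqrt (ln (2 * p) / n)"
      unfolding C1_def C2_def R_def by (rule real_bound_from_weights[OF l(1) l(3)])
    then have "loss \<le> ennreal (C1 * (sqrt l1 + sqrt l2) / sqrt n + C2 * sqrt (ln (2 * p) / n))"
      unfolding e by (rule ennreal_leI)
    also have "\<dots> = ennreal (C1 * (sqrt l1 + sqrt l2) / sqrt n) + ennreal (C2 * sqrt (ln (2 * p) / n))"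
      using C1 C2 l n_pos p_ge by (intro ennreal_plus) auto
    also have "ennreal (C1 * (sqrt l1 + sqrt l2) / sqrt n)
        = ennreal C1 * (ennreal_sqrt log_levels1 + ennreal_sqrt log_levels2) / ennreal (sqrt n)"
      using C1 l n_pos by (simp add: ennreal_sqrt_def divide_ennreal flip: ennreal_mult ennreal_plus)
    finally show ?thesis .
  qed
  show ?thesis
    unfolding Let_def logs
    \<comment> \<open>Adding the summand \<open>ennreal E\<close> only enlarges the right-hand side
      of \<open>main\<close>.\<close>
    using main unfolding loss_def ev_def C1_def C2_def n_def p_def L_def M_def
    by (rule order_trans) simp
qed

end
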